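(* There exists a $C^{1+ac}$-continuous path of germs at the origin of hyperbolic vector fields on the real line, passing through the (germ of the) linear vector field $X(x)=-x$, such that the time-$1$ maps of the flows are pairwise $C^1$ conjugate though pairwise non $C^{1+ac}$ conjugate (for distinct parameters of the path).
   Context: All germs are germs at $0$ of vector fields (resp. diffeomorphisms) on the real line having a singularity (resp. fixed point) at the origin. A germ of $C^1$ vector field $X$ with $X(0)=0$ is hyperbolic if $DX(0)\neq 0$. The time-$1$ map is the germ at $0$ of the time-$1$ map of the flow of $X$. A vector field or diffeomorphism is of class $C^{1+ac}$ if it is $C^1$ with (locally) absolutely continuous derivative. Germs of diffeomorphisms $f,g$ fixing $0$ are $C^1$ (resp. $C^{1+ac}$) conjugate if there is a germ $h$ of $C^1$ (resp. $C^{1+ac}$) diffeomorphism fixing $0$ such that $hfh^{-1}=g$ near $0$. A $C^{1+ac}$-continuous path of germs is a family $(X_\alpha)_{\alpha\in I}$ of germs of $C^{1+ac}$ vector fields, indexed by a nondegenerate interval $I\subset\mathbb{R}$, having representatives defined on a common neighborhood $[-\delta,\delta]$ of $0$ that depend continuously on $\alpha$ in the $C^{1+ac}$ topology on $[-\delta,\delta]$, i.e. for the norm $\|X\|_\infty+\|DX\|_\infty+\|D^2X\|_{L^1}$. *)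

theory Defs
  imports "HOL-Analysis.Analysis"
begin

text \<open>
  A germ at 0 is represented by a total function on the reals; only its values near 0 matter, and
  all predicates on germs below are invariant under \<open>germ_eq\<close>.
\<close>

definition germ_eq :: "(real \<Rightarrow> real) \<Rightarrow> (real \<Rightarrow> real) \<Rightarrow> bool" where
  "germ_eq f g \<longleftrightarrow> (\<forall>\<^sub>F x in nhds 0. f x = g x)"

text \<open>
  The library's \<open>absolutely_continuous\<close> relates measures; this is the epsilon-delta notion for
  functions. A pair \<open>(u, v)\<close> in \<open>D\<close> stands for the interval with end points \<open>u\<close> and \<open>v\<close>.
\<close>

definition abs_cont_on :: "real \<Rightarrow> real \<Rightarrow> (real \<Rightarrow> real) \<Rightarrow> bool" where
  "abs_cont_on a b f \<longleftrightarrow>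
     (\<forall>e>0. \<exists>d>0. \<forall>D :: (real \<times> real) set.
        finite D \<and> (\<forall>(u, v)\<in>D. a \<le> u \<and> u \<le> v \<and> v \<le> b) \<and>
        (\<forall>p\<in>D. \<forall>q\<in>D. p \<noteq> q \<longrightarrow> {fst p<..<snd p} \<inter> {fst q<..<snd q} = {}) \<and>
        (\<Sum>(u, v)\<in>D. v - u) < d
        \<longrightarrow> (\<Sum>(u, v)\<in>D. \<bar>f v - f u\<bar>) < e)"

text \<open>The derivative on the closed interval from \<open>a\<close> to \<open>b\<close>, one-sided at the end points.\<close>

definition deriv_on :: "real \<Rightarrow> real \<Rightarrow> (real \<Rightarrow> real) \<Rightarrow> real \<Rightarrow> real" where
  "deriv_on a b f x = vector_derivative f (at x within {a..b})"

definition C1ac_on :: "real \<Rightarrow> real \<Rightarrow> (real \<Rightarrow> real) \<Rightarrow> bool" where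
  "C1ac_on a b f \<longleftrightarrow>
     f differentiable_on {a..b} \<and> continuous_on {a..b} (deriv_on a b f) \<and>
     abs_cont_on a b (deriv_on a b f)"

text \<open>
  The norm is taken in \<^typ>\<open>ennreal\<close>, so that no suprema or integrals default to a junk value.
  For \<open>f\<close> in \<open>C1ac_on (-\<delta>) \<delta>\<close> it is finite, and the iterated derivative in the last summand is the
  genuine second derivative outside a Lebesgue null set, hence represents it in \<open>L\<^sup>1\<close>.
\<close>

definition C1ac_norm :: "real \<Rightarrow> (real \<Rightarrow> real) \<Rightarrow> ennreal" where
  "C1ac_norm \<delta> f =
     (SUP x\<in>{-\<delta>..\<delta>}. ennreal \<bar>f x\<bar>) +
     (SUP x\<in>{-\<delta>..\<delta>}. ennreal \<bar>deriv_on (-\<delta>) \<delta> f x\<bar>) +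
     (\<integral>\<^sup>+x\<in>{-\<delta>..\<delta>}. ennreal \<bar>deriv_on (-\<delta>) \<delta> (deriv_on (-\<delta>) \<delta> f) x\<bar> \<partial>lebesgue)"

definition C1_germ :: "(real \<Rightarrow> real) \<Rightarrow> bool" where
  "C1_germ f \<longleftrightarrow> (\<exists>\<epsilon>>0. f C1_differentiable_on {-\<epsilon><..<\<epsilon>})"

definition C1ac_germ :: "(real \<Rightarrow> real) \<Rightarrow> bool" where
  "C1ac_germ f \<longleftrightarrow> (\<exists>\<epsilon>>0. C1ac_on (-\<epsilon>) \<epsilon> f)"

definition hyperbolic_germ :: "(real \<Rightarrow> real) \<Rightarrow> bool" where
  "hyperbolic_germ X \<longleftrightarrow> C1_germ X \<and> X 0 = 0 \<and> deriv X 0 \<noteq> 0"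

definition C1ac_continuous_path :: "real set \<Rightarrow> (real \<Rightarrow> real \<Rightarrow> real) \<Rightarrow> bool" where
  "C1ac_continuous_path I X \<longleftrightarrow>
     is_interval I \<and> (\<exists>a\<in>I. \<exists>b\<in>I. a < b) \<and>
     (\<exists>\<delta>>0. \<exists>Y. (\<forall>\<alpha>\<in>I. germ_eq (Y \<alpha>) (X \<alpha>) \<and> C1ac_on (-\<delta>) \<delta> (Y \<alpha>)) \<and>
        (\<forall>\<alpha>\<in>I. ((\<lambda>\<beta>. C1ac_norm \<delta> (\<lambda>x. Y \<beta> x - Y \<alpha> x)) \<longlongrightarrow> 0) (at \<alpha> within I)))"

text \<open>
  \<open>f\<close> represents the germ of the time-1 map of the flow of \<open>X\<close>. For a \<open>C\<^sup>1\<close> germ \<open>X\<close> vanishing at 0,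
  orbits of points near 0 exist up to time 1, are unique, and stay in any prescribed neighbourhood
  of 0 once the starting point is close enough to 0; so this determines the germ of \<open>f\<close>, and depends
  only on the germ of \<open>X\<close>.
\<close>

definition time_one_germ :: "(real \<Rightarrow> real) \<Rightarrow> (real \<Rightarrow> real) \<Rightarrow> bool" where
  "time_one_germ X f \<longleftrightarrow>
     (\<forall>\<epsilon>>0. \<forall>\<^sub>F x in nhds 0. \<exists>\<phi>.
        \<phi> 0 = x \<and> \<phi> 1 = f x \<and>
        (\<forall>t\<in>{0..1}. \<bar>\<phi> t\<bar> < \<epsilon> \<and> (\<phi> has_real_derivative X (\<phi> t)) (at t within {0..1})))"

text \<open>\<open>h\<close> is a germ of a \<open>C\<^sup>1\<close> diffeomorphism fixing 0, with inverse germ \<open>k\<close>.\<close>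

definition C1_diffeo_germ :: "(real \<Rightarrow> real) \<Rightarrow> (real \<Rightarrow> real) \<Rightarrow> bool" where
  "C1_diffeo_germ h k \<longleftrightarrow>
     h 0 = 0 \<and> k 0 = 0 \<and> C1_germ h \<and> C1_germ k \<and>
     germ_eq (h \<circ> k) id \<and> germ_eq (k \<circ> h) id"

definition C1_conjugate :: "(real \<Rightarrow> real) \<Rightarrow> (real \<Rightarrow> real) \<Rightarrow> bool" where
  "C1_conjugate f g \<longleftrightarrow> (\<exists>h k. C1_diffeo_germ h k \<and> germ_eq (h \<circ> f \<circ> k) g)"

text \<open>
  A diffeomorphism is of class \<open>C1ac\<close> when it is \<open>C\<^sup>1\<close> with absolutely continuous derivative; its
  inverse then automatically has the same regularity.
\<close>

definition C1ac_conjugate :: "(real \<Rightarrow> real) \<Rightarrow> (real \<Rightarrow> real) \<Rightarrow> bool" where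
  "C1ac_conjugate f g \<longleftrightarrow>
     (\<exists>h k. C1_diffeo_germ h k \<and> C1ac_germ h \<and> germ_eq (h \<circ> f \<circ> k) g)"

end

theory Submission
  imports Defs
begin

text \<open>
  In the coordinate \<open>u = - ln \<bar>x\<bar>\<close> the vector field \<open>- x\<close> becomes the unit field, and multiplication
  by \<open>exp (- 1)\<close> becomes \<open>u \<mapsto> u + 1\<close>. The function \<open>\<eta> u = sin (ln u) / ln u\<close> tends to 0 with unbounded
  variation, while its second and third derivatives are integrable at infinity. The path is
  \<open>X\<^sub>\<alpha> x = - x (1 + \<alpha> \<eta>' u)\<close>, affine in \<open>\<alpha>\<close>; its second derivative in \<open>x\<close> is dominated by a multiple
  of \<open>1 / (\<bar>x\<bar> u\<^sup>2)\<close>, which is integrable. The time coordinate \<open>T\<^sub>\<alpha>\<close> of \<open>X\<^sub>\<alpha>\<close> satisfies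
  \<open>T\<^sub>\<alpha> u = u - \<alpha> \<eta> u + O(1 / u)\<close>, so \<open>T\<^sub>\<alpha> u - u\<close> converges and \<open>T\<^sub>\<alpha>\<close> induces a \<open>C\<^sup>1\<close> linearization.
  A \<open>C\<^sup>1\<close> germ commuting with \<open>x \<mapsto> exp (- 1) x\<close> is linear, hence every \<open>C\<^sup>1\<close> conjugacy \<open>h\<close> from the
  time-1 map of \<open>X\<^sub>\<alpha>\<close> to that of \<open>X\<^sub>\<beta>\<close> is linear in the linearizing coordinates. This gives
  \<open>ln \<bar>h' x\<bar> = c + (\<alpha> - \<beta>) \<eta> u + O(1 / u)\<close>. Along \<open>ln u = n \<pi> + \<pi> / 2\<close> the increments of this function
  are at least of order \<open>1 / n\<close>, so \<open>h'\<close> has infinite variation unless \<open>\<alpha> = \<beta>\<close>.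
\<close>

subsection \<open>The oscillating function\<close>

definition sinc :: "real \<Rightarrow> real" where
  "sinc l = sin l / l"

text \<open>The successive derivatives of \<open>sinc\<close> in closed form. Three are needed
  because the second derivative of the field involves the third derivative of the wave.\<close>

definition sinc1 :: "real \<Rightarrow> real" where
  "sinc1 l = cos l / l - sin l / l^2"

definition sinc2 :: "real \<Rightarrow> real" where
  "sinc2 l = - sin l / l - 2 * cos l / l^2 + 2 * sin l / l^3"

definition sinc3 :: "real \<Rightarrow> real" where
  "sinc3 l = - cos l / l + 3 * sin l / l^2 + 6 * cos l / l^3 - 6 * sin l / l^4"

lemma sinc_derivs:
  assumes "l \<noteq> 0"
  shows "(sinc has_real_derivative sinc1 l) (at l)"
    and "(sinc1 has_real_derivative sinc2 l) (at l)"
    and "(sinc2 has_real_derivative sinc3 l) (at l)"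
  using assms unfolding sinc_def[abs_def] sinc1_def[abs_def] sinc2_def[abs_def] sinc3_def
  by (auto intro!: derivative_eq_intros simp: field_simps eval_nat_numeral)

lemma abs_divide_power_le:
  fixes a l :: real
  assumes "1 \<le> l" "\<bar>a\<bar> \<le> 1"
  shows "\<bar>a / l ^ n\<bar> \<le> 1"
proof -
  have "1 \<le> l ^ n" using assms by simp
  then have "\<bar>a\<bar> \<le> l ^ n" using assms by linarith
  then show ?thesis using assms by (simp add: abs_divide divide_le_eq)
qed

text \<open>For l \<ge> 1 every quotient of a sine or cosine by a power of l is at most 1 in
  absolute value, so the constants are sums of absolute coefficients: 2 = 1 + 1, 5 = 1 + 2 + 2, 16 =
  1 + 3 + 6 + 6.\<close>

lemma sinc_bounds:
  assumes "1 \<le> l"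
  shows "\<bar>sinc l\<bar> \<le> 1 / l" "\<bar>sinc1 l\<bar> \<le> 2" "\<bar>sinc2 l\<bar> \<le> 5" "\<bar>sinc3 l\<bar> \<le> 16"
proof -
  have s: "\<bar>sin l / l ^ n\<bar> \<le> 1" and c: "\<bar>cos l / l ^ n\<bar> \<le> 1" for n
    using abs_divide_power_le[OF assms] by auto
  note * = s[of 1] s[of 2] s[of 3] s[of 4] c[of 1] c[of 2] c[of 3]
  show "\<bar>sinc l\<bar> \<le> 1 / l"
    using assms by (simp add: sinc_def abs_divide divide_right_mono)
  show "\<bar>sinc1 l\<bar> \<le> 2" "\<bar>sinc2 l\<bar> \<le> 5" "\<bar>sinc3 l\<bar> \<le> 16"
    unfolding sinc1_def sinc2_def sinc3_def
    using * by (simp_all only: times_divide_eq_right[symmetric] minus_divide_left[symmetric] power_one_right)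
qed

text \<open>The function \<eta> of the overview. The logarithm inside makes each further derivative
  gain a factor 1 / u.\<close>

definition wave :: "real \<Rightarrow> real" where
  "wave u = sinc (ln u)"

definition wave1 :: "real \<Rightarrow> real" where
  "wave1 u = sinc1 (ln u) / u"

definition wave2 :: "real \<Rightarrow> real" where
  "wave2 u = (sinc2 (ln u) - sinc1 (ln u)) / u^2"

definition wave3 :: "real \<Rightarrow> real" where
  "wave3 u = (sinc3 (ln u) - 3 * sinc2 (ln u) + 2 * sinc1 (ln u)) / u^3"

lemma wave_derivs:
  assumes "1 < u"
  shows "(wave has_real_derivative wave1 u) (at u)"
    and "(wave1 has_real_derivative wave2 u) (at u)"
    and "(wave2 has_real_derivative wave3 u) (at u)"
proof -
  have n: "ln u \<noteq> 0" using assms by simp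
  have c: "((\<lambda>u. f (ln u)) has_real_derivative y) (at u)"
    if "(f has_real_derivative D) (at (ln u))" "D / u = y" for f D y
    using DERIV_chain2[OF that(1) DERIV_ln_divide] that(2) assms by simp
  note d = c[of sinc, OF sinc_derivs(1)[OF n]] c[of sinc1, OF sinc_derivs(2)[OF n]]
    c[of sinc2, OF sinc_derivs(3)[OF n]]
  show "(wave has_real_derivative wave1 u) (at u)"
    unfolding wave_def[abs_def] wave1_def using assms
    by (auto intro!: derivative_eq_intros d)
  show "(wave1 has_real_derivative wave2 u) (at u)"
    unfolding wave1_def[abs_def] wave2_def using assms
    by (auto intro!: derivative_eq_intros d simp: power2_eq_square)
  show "(wave2 has_real_derivative wave3 u) (at u)"
    unfolding wave2_def[abs_def] wave3_def using assms
    by (auto intro!: derivative_eq_intros d simp: field_simps eval_nat_numeral)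
qed

lemma one_le_ln_4: "1 \<le> ln (4::real)"
proof -
  have "exp 1 \<le> (4::real)" using exp_le by linarith
  then show ?thesis by (simp add: ln_ge_iff)
qed

lemma one_le_ln: "4 \<le> u \<Longrightarrow> 1 \<le> ln (u::real)"
  using one_le_ln_4 ln_mono[of 4 u] by linarith

text \<open>The constants combine those of \<open>sinc_bounds\<close>: 7 = 5 + 2 and 35 = 16 + 3 * 5
  + 2 * 2. The threshold 4 is a convenient number above exp 1, so that ln u \<ge> 1.\<close>

lemma wave_bounds:
  assumes "4 \<le> u"
  shows "\<bar>wave u\<bar> \<le> 1 / ln u" "\<bar>wave1 u\<bar> \<le> 2 / u" "\<bar>wave2 u\<bar> \<le> 7 / u^2" "\<bar>wave3 u\<bar> \<le> 35 / u^3"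
proof -
  note b = sinc_bounds[OF one_le_ln[OF assms]]
  have "0 < u" using assms by simp
  then show "\<bar>wave u\<bar> \<le> 1 / ln u" "\<bar>wave1 u\<bar> \<le> 2 / u" "\<bar>wave2 u\<bar> \<le> 7 / u^2" "\<bar>wave3 u\<bar> \<le> 35 / u^3"
    using b unfolding wave_def wave1_def wave2_def wave3_def by (simp_all add: abs_divide divide_right_mono)
qed

text \<open>
  Freezing the slope below \<open>4\<close> makes the time coordinate a diffeomorphism of the whole line without
  changing the germ.
\<close>

definition slope :: "real \<Rightarrow> real" where
  "slope u = wave1 (max 4 u)"

text \<open>The uniform bound 1/2 = 2/4 keeps \<open>1 + \<alpha> * slope u\<close> away from zero
  for all \<bar>\<alpha>\<bar> \<le> 1, which allows the parameter interval from -1 to 1.\<close>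

lemma slope_bounds: "\<bar>slope u\<bar> \<le> 1/2" "4 \<le> u \<Longrightarrow> \<bar>slope u\<bar> \<le> 2 / u"
proof -
  show "\<bar>slope u\<bar> \<le> 1/2"
  proof -
    have "2 / max 4 u \<le> 2 / 4" by (rule divide_left_mono) auto
    then show ?thesis unfolding slope_def using wave_bounds(2)[of "max 4 u"] by linarith
  qed
  show "4 \<le> u \<Longrightarrow> \<bar>slope u\<bar> \<le> 2 / u"
    unfolding slope_def using wave_bounds(2)[of u] by (simp add: max_absorb2)
qed

lemma continuous_on_slope: "continuous_on A slope"
proof -
  have "continuous_on {4..} wave1"
  proof (rule DERIV_continuous_on)
    show "(wave1 has_real_derivative wave2 u) (at u within {4..})" if "u \<in> {4..}" for u
      using that by (intro has_field_derivative_at_within[OF wave_derivs(2)]) auto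
  qed
  moreover have "continuous_on UNIV (\<lambda>u::real. max 4 u)" by (intro continuous_intros)
  ultimately have "continuous_on UNIV (\<lambda>u. wave1 (max 4 u))"
    by (rule continuous_on_compose2) auto
  then show ?thesis unfolding slope_def[abs_def] by (rule continuous_on_subset) auto
qed

lemma tendsto_divide_at_top: "((\<lambda>u. K / u) \<longlongrightarrow> (0::real)) at_top"
  by (rule tendsto_divide_0[OF tendsto_const filterlim_at_top_imp_at_infinity[OF filterlim_ident]])

lemma slope_tendsto: "(slope \<longlongrightarrow> 0) at_top"
  by (rule Lim_null_comparison[OF _ tendsto_divide_at_top[of 2]])
    (auto intro!: eventually_at_top_linorderI[of 4] slope_bounds(2))

lemma wave_tendsto: "(wave \<longlongrightarrow> 0) at_top"
proof (rule Lim_null_comparison)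
  show "\<forall>\<^sub>F u in at_top. norm (wave u) \<le> 1 / ln u"
    by (auto intro!: eventually_at_top_linorderI[of 4] wave_bounds(1))
  show "((\<lambda>u. 1 / ln u) \<longlongrightarrow> (0::real)) at_top"
    by (rule filterlim_compose[OF tendsto_divide_at_top ln_at_top])
qed

subsection \<open>Linearizing time coordinates\<close>

lemma mult_slope_bounds:
  assumes "\<bar>\<alpha>\<bar> \<le> 1"
  shows "\<bar>\<alpha> * slope u\<bar> \<le> 1/2" "1/2 \<le> 1 + \<alpha> * slope u" "1 + \<alpha> * slope u \<le> 3/2"
proof -
  show "\<bar>\<alpha> * slope u\<bar> \<le> 1/2"
    using mult_mono[OF assms slope_bounds(1)[of u]] by (simp add: abs_mult)
  then show "1/2 \<le> 1 + \<alpha> * slope u" "1 + \<alpha> * slope u \<le> 3/2" by (auto simp: abs_le_iff)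
qed

text \<open>
  The antiderivative is normalized so that the remainder, whose derivative is \<open>O(1 / u\<^sup>2)\<close>,
  vanishes at infinity.
\<close>

lemma exists_clock:
  assumes a: "\<bar>\<alpha>\<bar> \<le> 1"
  shows "\<exists>T. (\<forall>u. (T has_real_derivative 1 / (1 + \<alpha> * slope u)) (at u)) \<and>
             (\<forall>u\<ge>4. \<bar>T u - (u - \<alpha> * wave u)\<bar> \<le> 8 / u)"
proof -
  have nz: "1 + \<alpha> * slope u \<noteq> 0" for u using mult_slope_bounds(2)[OF a, of u] by simp
  have c: "isCont (\<lambda>u. 1 / (1 + \<alpha> * slope u)) u" for u
    using continuous_on_slope[of UNIV] nz
    by (auto intro!: continuous_intros simp: continuous_on_eq_continuous_at)
  have "\<exists>F. \<forall>u. - \<infinity> < ereal u \<longrightarrow> ereal u < \<infinity> \<longrightarrow>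
      (F has_vector_derivative 1 / (1 + \<alpha> * slope u)) (at u)"
    by (rule einterval_antiderivative) (use c in auto)
  then obtain T0 where T0: "(T0 has_real_derivative 1 / (1 + \<alpha> * slope u)) (at u)" for u
    by (auto simp: has_real_derivative_iff_has_vector_derivative)
  define R where "R u = T0 u - (u - \<alpha> * wave u)" for u
  \<comment> \<open>With s = \<open>\<alpha> * slope u\<close>, the derivative of R is 1 / (1 + s) -
    (1 - s) = s^2 / (1 + s): the term linear in s cancels, leaving a nonnegative quantity of order 1
    / u^2.\<close>
  define r where "r u = (\<alpha> * slope u)^2 / (1 + \<alpha> * slope u)" for u
  have dR: "(R has_real_derivative r u) (at u)" if "4 \<le> u" for u
  proof -
    have "wave1 u = slope u" using that by (simp add: slope_def max_absorb2)
    then have "(wave has_real_derivative slope u) (at u)"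
      using wave_derivs(1)[of u] that by simp
    then show ?thesis
      unfolding R_def[abs_def] r_def using nz[of u]
      by (auto intro!: derivative_eq_intros T0 simp: field_simps power2_eq_square)
  qed
  have r: "0 \<le> r u" "4 \<le> u \<Longrightarrow> r u \<le> 8 / u^2" for u
  proof -
    show "0 \<le> r u" using mult_slope_bounds(2)[OF a, of u] by (simp add: r_def)
    assume u: "4 \<le> u"
    have "\<bar>\<alpha> * slope u\<bar> \<le> 2 / u"
      using mult_mono[OF a slope_bounds(2)[OF u]] by (simp add: abs_mult)
    then have "(\<alpha> * slope u)^2 \<le> (2/u)^2"
      using abs_le_square_iff[of "\<alpha> * slope u" "2/u"] u by simp
    then have "r u \<le> (2/u)^2 / (1/2)"
      unfolding r_def using mult_slope_bounds(2)[OF a, of u] by (intro frac_le) auto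
    then show "r u \<le> 8 / u^2" by (simp add: power_divide)
  qed
  have mono: "R u \<le> R v" if "4 \<le> u" "u \<le> v" for u v
  proof (rule DERIV_nonneg_imp_nondecreasing[OF that(2)])
    fix x assume "u \<le> x" "x \<le> v"
    then have "4 \<le> x" using that(1) by simp
    from dR[OF this] r(1) show "\<exists>y. (R has_real_derivative y) (at x) \<and> 0 \<le> y" by blast
  qed
  \<comment> \<open>The derivative - 8 / x^2 of 8 / x compensates the upper bound on r, so R x + 8 /
    x decreases.\<close>
  have anti: "R v \<le> R u + 8 / u" if "4 \<le> u" "u \<le> v" for u v
  proof -
    have "R v + 8 / v \<le> R u + 8 / u"
    proof (rule DERIV_nonpos_imp_nonincreasing[OF that(2)])
      fix x assume "u \<le> x" "x \<le> v"
      then have x: "4 \<le> x" using that by simp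
      then have "((\<lambda>x. R x + 8 / x) has_real_derivative r x - 8 / x^2) (at x)"
        by (auto intro!: derivative_eq_intros dR simp: power2_eq_square)
      then show "\<exists>y. ((\<lambda>x. R x + 8 / x) has_real_derivative y) (at x) \<and> y \<le> 0"
        using r(2)[OF x] by force
    qed
    moreover have "0 \<le> 8 / v" using that by (intro divide_nonneg_pos) auto
    ultimately show ?thesis by linarith
  qed
  \<comment> \<open>R is nondecreasing and bounded on {4..}, so this supremum is its limit at
    infinity; subtracting it from the antiderivative gives the required normalization.\<close>
  define L where "L = (SUP u\<in>{4..}. R u)"
  have bdd: "bdd_above (R ` {4..})"
    by (rule bdd_aboveI2[of _ _ "R 4 + 2"]) (use anti[of 4] in auto)
  have L1: "R u \<le> L" if "4 \<le> u" for u
    unfolding L_def by (rule cSUP_upper[OF _ bdd]) (use that in auto)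
  have L2: "L \<le> R u + 8 / u" if "4 \<le> u" for u
    unfolding L_def
  proof (rule cSUP_least)
    fix v :: real assume "v \<in> {4..}"
    then have "R v \<le> R (max u v)" "R (max u v) \<le> R u + 8 / u"
      using that by (intro mono anti; simp)+
    then show "R v \<le> R u + 8 / u" by simp
  qed simp
  have "((\<lambda>u. T0 u - L) has_real_derivative 1 / (1 + \<alpha> * slope u)) (at u)" for u
    by (auto intro!: derivative_eq_intros T0)
  moreover have "\<bar>(T0 u - L) - (u - \<alpha> * wave u)\<bar> \<le> 8 / u" if "4 \<le> u" for u
    using L1[OF that] L2[OF that] by (auto simp: R_def abs_le_iff)
  ultimately show ?thesis by (intro exI[of _ "\<lambda>u. T0 u - L"]) auto
qed

text \<open>The time along orbits of u' = \<open>1 + \<alpha> * slope u\<close>. For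
  \<bar>\<alpha>\<bar> \<le> 1 the choice is unique: the first condition fixes T up to a constant,
  and the decay in the second fixes the constant.\<close>

definition clock :: "real \<Rightarrow> real \<Rightarrow> real" where
  "clock \<alpha> = (SOME T. (\<forall>u. (T has_real_derivative 1 / (1 + \<alpha> * slope u)) (at u)) \<and>
                      (\<forall>u\<ge>4. \<bar>T u - (u - \<alpha> * wave u)\<bar> \<le> 8 / u))"

definition unclock :: "real \<Rightarrow> real \<Rightarrow> real" where
  "unclock \<alpha> = inv (clock \<alpha>)"

context
  fixes \<alpha> :: real
  assumes a: "\<bar>\<alpha>\<bar> \<le> 1"
begin

lemma clock_deriv: "(clock \<alpha> has_real_derivative 1 / (1 + \<alpha> * slope u)) (at u)"
  and clock_approx: "4 \<le> u \<Longrightarrow> \<bar>clock \<alpha> u - (u - \<alpha> * wave u)\<bar> \<le> 8 / u"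
  using someI_ex[OF exists_clock[OF a]] unfolding clock_def by blast+

text \<open>The derivative is at least 2/3, because \<open>1 + \<alpha> * slope u\<close> is at most
  3/2. The linear lower bound yields injectivity, surjectivity and a Lipschitz inverse.\<close>

lemma clock_expanding:
  assumes "u \<le> v"
  shows "(v - u) / 2 \<le> clock \<alpha> v - clock \<alpha> u"
proof -
  have "clock \<alpha> u - u / 2 \<le> clock \<alpha> v - v / 2"
  proof (rule DERIV_nonneg_imp_nondecreasing[OF assms])
    fix x
    have "1/2 \<le> 1 / (1 + \<alpha> * slope x)"
      using mult_slope_bounds[OF a, of x] by (simp add: field_simps)
    then show "\<exists>y. ((\<lambda>x. clock \<alpha> x - x / 2) has_real_derivative y) (at x) \<and> 0 \<le> y"
      by (intro exI[of _ "1 / (1 + \<alpha> * slope x) - 1/2"] conjI)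
        (auto intro!: derivative_eq_intros clock_deriv)
  qed
  then show ?thesis by (simp add: field_simps)
qed

lemma clock_less: "u < v \<Longrightarrow> clock \<alpha> u < clock \<alpha> v"
  using clock_expanding[of u v] by simp

lemma clock_less_iff: "clock \<alpha> u < clock \<alpha> v \<longleftrightarrow> u < v"
  by (metis clock_less less_asym less_irrefl linorder_neqE_linordered_idom)

lemma bij_clock: "bij (clock \<alpha>)"
proof (rule bijI)
  show "inj (clock \<alpha>)" by (rule injI) (metis clock_less less_irrefl linorder_neqE_linordered_idom)
  have "\<exists>u. clock \<alpha> u = y" for y
  proof -
    \<comment> \<open>Growth at rate at least 1/2 on both sides of 0 makes the values at -b and b
      bracket y.\<close>
    define b where "b = 2 * \<bar>y - clock \<alpha> 0\<bar>"
    have "clock \<alpha> (-b) \<le> y" "y \<le> clock \<alpha> b"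
      using clock_expanding[of "-b" 0] clock_expanding[of 0 b] by (auto simp: b_def)
    moreover have "-b \<le> b" by (simp add: b_def)
    ultimately obtain u where "clock \<alpha> u = y"
      using IVT[of "clock \<alpha>" "-b" y b] DERIV_isCont[OF clock_deriv] by blast
    then show ?thesis ..
  qed
  then show "surj (clock \<alpha>)" unfolding surj_def by metis
qed

lemma clock_unclock [simp]: "clock \<alpha> (unclock \<alpha> t) = t"
  and unclock_clock [simp]: "unclock \<alpha> (clock \<alpha> u) = u"
  using bij_clock by (simp_all add: unclock_def bij_is_surj surj_f_inv_f bij_is_inj inv_f_f)

lemma unclock_less_iff: "unclock \<alpha> s < unclock \<alpha> t \<longleftrightarrow> s < t"
  using clock_less_iff[of "unclock \<alpha> s" "unclock \<alpha> t"] by simp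

lemma unclock_le_iff: "unclock \<alpha> s \<le> unclock \<alpha> t \<longleftrightarrow> s \<le> t"
  by (meson unclock_less_iff linorder_not_le)

lemma unclock_contracting: "s \<le> t \<Longrightarrow> unclock \<alpha> t - unclock \<alpha> s \<le> 2 * (t - s)"
  using clock_expanding[of "unclock \<alpha> s" "unclock \<alpha> t"] by (simp add: unclock_le_iff)

text \<open>The inverse of a map expanding by 1/2 is 2-Lipschitz. Continuity is what the inverse
  function rule asks for in the next lemma.\<close>

lemma isCont_unclock: "isCont (unclock \<alpha>) t"
proof -
  have "dist (unclock \<alpha> s) (unclock \<alpha> t) \<le> 2 * dist s t" for s t
    using unclock_contracting[of s t] unclock_contracting[of t s]
      unclock_le_iff[of s t] unclock_le_iff[of t s]
    unfolding dist_real_def by (cases "s \<le> t") auto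
  then have "2-lipschitz_on UNIV (unclock \<alpha>)" by (intro lipschitz_onI) auto
  then show ?thesis
    using lipschitz_on_continuous_on continuous_on_eq_continuous_at open_UNIV by blast
qed

lemma unclock_deriv: "(unclock \<alpha> has_real_derivative 1 + \<alpha> * slope (unclock \<alpha> t)) (at t)"
proof -
  have nz: "1 + \<alpha> * slope (unclock \<alpha> t) \<noteq> 0"
    using mult_slope_bounds(2)[OF a, of "unclock \<alpha> t"] by simp
  have "(unclock \<alpha> has_real_derivative inverse (1 / (1 + \<alpha> * slope (unclock \<alpha> t)))) (at t)"
    using nz by (intro DERIV_inverse_function[where f = "clock \<alpha>" and a = "t - 1" and b = "t + 1"]
        clock_deriv isCont_unclock) auto
  then show ?thesis by simp
qed

text \<open>Both the wave and the O(1 / u) remainder vanish at infinity. Through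
  \<open>lift_deriv_0\<close> this limit makes the lifted clock tangent to the identity at the
  origin.\<close>

lemma clock_asymp: "((\<lambda>u. clock \<alpha> u - u) \<longlongrightarrow> 0) at_top"
proof -
  have 1: "((\<lambda>u. clock \<alpha> u - (u - \<alpha> * wave u)) \<longlongrightarrow> 0) at_top"
    by (rule Lim_null_comparison[OF _ tendsto_divide_at_top[of 8]])
      (auto intro!: eventually_at_top_linorderI[of 4] clock_approx)
  show ?thesis using tendsto_diff[OF 1 tendsto_mult_right_zero[OF wave_tendsto, of \<alpha>]] by simp
qed

lemma unclock_at_top: "filterlim (unclock \<alpha>) at_top at_top"
  unfolding filterlim_at_top
proof
  fix Z
  show "\<forall>\<^sub>F t in at_top. Z \<le> unclock \<alpha> t"
    by (rule eventually_at_top_linorderI[of "clock \<alpha> Z"])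
      (metis unclock_clock unclock_le_iff)
qed

lemma unclock_asymp: "((\<lambda>t. unclock \<alpha> t - t) \<longlongrightarrow> 0) at_top"
  using tendsto_minus[OF filterlim_compose[OF clock_asymp unclock_at_top]] by simp

lemma clock_at_top: "filterlim (clock \<alpha>) at_top at_top"
  unfolding filterlim_at_top
proof
  fix Z
  show "\<forall>\<^sub>F t in at_top. Z \<le> clock \<alpha> t"
    by (rule eventually_at_top_linorderI[of "unclock \<alpha> Z"])
      (metis clock_unclock clock_less_iff linorder_not_le)
qed

lemma isCont_mult_slope: "isCont (\<lambda>u. 1 + \<alpha> * slope u) u"
  using continuous_on_slope[of UNIV]
  by (auto intro!: continuous_intros simp: continuous_on_eq_continuous_at)

lemma mult_slope_tendsto: "((\<lambda>u. 1 + \<alpha> * slope u) \<longlongrightarrow> 1) at_top"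
  using tendsto_add[OF tendsto_const tendsto_mult_right_zero[OF slope_tendsto]] by simp

lemma mult_slope_pos: "0 < 1 + \<alpha> * slope u"
  using mult_slope_bounds(2)[OF a, of u] by linarith

end

subsection \<open>Maps of the line in logarithmic coordinates\<close>

text \<open>
  At \<open>x = 0\<close> the junk value \<open>ln 0\<close> is harmless, since \<open>sgn 0 = 0\<close>.
\<close>

definition lift :: "(real \<Rightarrow> real) \<Rightarrow> real \<Rightarrow> real" where
  "lift P x = sgn x * exp (- P (- ln \<bar>x\<bar>))"

lemma lift_0 [simp]: "lift P 0 = 0"
  by (simp add: lift_def)

lemma sgn_lift [simp]: "sgn (lift P x) = sgn x"
  by (simp add: lift_def sgn_mult)

lemma abs_lift: "x \<noteq> 0 \<Longrightarrow> \<bar>lift P x\<bar> = exp (- P (- ln \<bar>x\<bar>))"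
  by (simp add: lift_def abs_mult abs_sgn_eq)

lemma lift_lift: "lift P (lift Q x) = lift (\<lambda>u. P (Q u)) x"
  by (cases "x = 0") (simp_all add: lift_def[of P "lift Q x"] abs_lift, simp add: lift_def)

lemma lift_ident [simp]: "lift (\<lambda>u. u) x = x"
  by (cases "x = 0") (simp_all add: lift_def sgn_mult_abs)

lemma lift_scale: "c \<noteq> 0 \<Longrightarrow> c * lift P x = sgn c * lift (\<lambda>u. P u - ln \<bar>c\<bar>) x"
  by (simp add: lift_def exp_diff exp_minus field_simps) (metis abs_mult_sgn mult.commute)

lemma lift_sgn_mult: "c \<noteq> 0 \<Longrightarrow> lift P (sgn c * x) = sgn c * lift P x"
  by (simp add: lift_def sgn_mult abs_mult abs_sgn_eq)

lemma filterlim_minus_ln_abs: "filterlim (\<lambda>x::real. - ln \<bar>x\<bar>) at_top (at 0)"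
proof -
  have "filterlim (\<lambda>x::real. \<bar>x\<bar>) (at_right 0) (at 0)"
    unfolding filterlim_at
    by (auto intro!: tendsto_eq_intros simp: eventually_at_filter)
  from filterlim_compose[OF ln_at_0 this] show ?thesis
    by (simp add: filterlim_uminus_at_top)
qed

lemma lift_quotient: "x \<noteq> 0 \<Longrightarrow> lift P x / x = exp (- (P (- ln \<bar>x\<bar>) - (- ln \<bar>x\<bar>)))"
proof -
  assume x: "x \<noteq> 0"
  have "exp (ln \<bar>x\<bar>) = \<bar>x\<bar>" using x by simp
  then show ?thesis using x
    by (simp add: lift_def exp_diff exp_minus exp_add field_simps sgn_if)
qed

text \<open>With u = - ln \<bar>x\<bar>, the difference quotient at 0 is exp (- (P u - u)), so
  differentiability at 0 is convergence of P u - u at infinity.\<close>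

lemma lift_deriv_0:
  assumes "((\<lambda>u. P u - u) \<longlongrightarrow> c) at_top"
  shows "(lift P has_real_derivative exp (- c)) (at 0)"
proof -
  have "((\<lambda>x. exp (- (P (- ln \<bar>x\<bar>) - (- ln \<bar>x\<bar>)))) \<longlongrightarrow> exp (- c)) (at 0)"
    by (intro tendsto_intros filterlim_compose[OF assms filterlim_minus_ln_abs])
  then have "((\<lambda>x. lift P x / x) \<longlongrightarrow> exp (- c)) (at 0)"
    by (rule Lim_transform_eventually)
      (auto simp: eventually_at_filter lift_quotient intro!: always_eventually)
  then show ?thesis by (simp add: has_field_derivative_iff)
qed

lemma lift_deriv:
  assumes x: "x \<noteq> 0" and u: "u = - ln \<bar>x\<bar>" and P: "(P has_real_derivative d) (at u)"
  shows "(lift P has_real_derivative exp (u - P u) * d) (at x)"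
proof -
  \<comment> \<open>On the side of the origin containing x the sign is constant and \<bar>y\<bar> =
    s * y, which removes the absolute value before differentiating.\<close>
  define s where "s = sgn x"
  have s: "\<bar>x\<bar> = s * x" "s * s = 1" "0 < s * x" using x by (auto simp: s_def sgn_if)
  have "(P has_real_derivative d) (at (- ln (s * x)))" using P u s(1) by simp
  moreover have "((\<lambda>y. - ln (s * y)) has_real_derivative - (1 / x)) (at x)"
    using s x by (auto intro!: derivative_eq_intros)
  ultimately have "((\<lambda>y. P (- ln (s * y))) has_real_derivative d * - (1 / x)) (at x)"
    by (rule DERIV_chain2)
  then have "((\<lambda>y. s * exp (- P (- ln (s * y)))) has_real_derivative
      s * (exp (- P (- ln (s * x))) * - (d * - (1 / x)))) (at x)"
    by (rule DERIV_cmult[OF DERIV_fun_exp[OF DERIV_minus]])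
  moreover have "s * (exp (- P (- ln (s * x))) * - (d * - (1 / x))) = exp (u - P u) * d"
  proof -
    have "exp u = 1 / (s * x)" using s u by (simp add: exp_minus inverse_eq_divide)
    also have "\<dots> = s / x" using x by (simp add: s_def sgn_if)
    finally have "exp u = s / x" .
    then show ?thesis using u s(1) by (simp add: exp_diff exp_minus field_simps)
  qed
  ultimately have "((\<lambda>y. s * exp (- P (- ln (s * y)))) has_real_derivative exp (u - P u) * d) (at x)"
    by simp
  then show ?thesis
  proof (rule has_field_derivative_transform_within_open)
    show "open {y. 0 < s * y}" by (intro open_Collect_less continuous_intros)
    show "x \<in> {y. 0 < s * y}" using s by simp
    show "s * exp (- P (- ln (s * y))) = lift P y" if "y \<in> {y. 0 < s * y}" for y
    proof -
      have "sgn (s * y) = 1" using that by simp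
      then have "sgn y = s" "\<bar>y\<bar> = s * y"
        using x unfolding s_def by (auto simp: sgn_if split: if_splits)
      then show ?thesis by (simp add: lift_def)
    qed
  qed
qed

text \<open>Away from 0 the derivative is exp (u - P u) * P' u; the two limits at infinity say that
  it extends continuously to the origin by the derivative exp (- c) found there.\<close>

lemma C1_germ_lift:
  assumes P: "\<And>u. (P has_real_derivative P' u) (at u)"
    and cont: "\<And>u. isCont P' u"
    and P'_lim: "(P' \<longlongrightarrow> 1) at_top"
    and lim: "((\<lambda>u. P u - u) \<longlongrightarrow> c) at_top"
  shows "C1_germ (lift P)"
proof -
  define E where "E u = exp (u - P u) * P' u" for u
  define D where "D x = (if x = 0 then exp (- c) else E (- ln \<bar>x\<bar>))" for x
  have D: "(lift P has_real_derivative D x) (at x)" for x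
    using lift_deriv_0[OF lim] lift_deriv[OF _ refl P] by (simp add: D_def E_def)
  have "isCont D x" for x
  proof (cases "x = 0")
    case True
    have "((\<lambda>u. exp (- (P u - u)) * P' u) \<longlongrightarrow> exp (- c) * 1) at_top"
      by (intro tendsto_intros lim P'_lim)
    then have "(E \<longlongrightarrow> exp (- c)) at_top" by (simp add: E_def[abs_def])
    from filterlim_compose[OF this filterlim_minus_ln_abs]
    have "(D \<longlongrightarrow> exp (- c)) (at 0)"
      by (rule Lim_transform_eventually) (auto simp: eventually_at_filter D_def intro!: always_eventually)
    then show ?thesis using True by (simp add: isCont_def D_def)
  next
    case False
    have "isCont E u" for u
      unfolding E_def[abs_def] by (intro continuous_intros cont DERIV_isCont[OF P])
    then have "isCont (\<lambda>x. E (- ln \<bar>x\<bar>)) x"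
      by (rule isCont_o2[rotated]) (use False in \<open>auto intro!: continuous_intros\<close>)
    moreover have "\<forall>\<^sub>F y in nhds x. E (- ln \<bar>y\<bar>) = D y"
      using t1_space_nhds[OF False] by eventually_elim (simp add: D_def)
    ultimately show ?thesis using isCont_cong[of "\<lambda>x. E (- ln \<bar>x\<bar>)" D x] by simp
  qed
  then have "continuous_on UNIV D" by (simp add: continuous_at_imp_continuous_on)
  then have "lift P C1_differentiable_on {-1<..<1}"
    unfolding C1_differentiable_on_def
    using D by (intro exI[of _ D])
      (auto simp: has_real_derivative_iff_has_vector_derivative intro: continuous_on_subset)
  then show ?thesis unfolding C1_germ_def by (intro exI[of _ 1]) simp
qed

subsection \<open>The path of vector fields and its time maps\<close>

text \<open>In u = - ln \<bar>x\<bar> this is the equation u' =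
  \<open>1 + \<alpha> * slope u\<close>, which \<open>clock\<close> straightens.\<close>

definition hyp_field :: "real \<Rightarrow> real \<Rightarrow> real" where
  "hyp_field \<alpha> x = - (x * (1 + \<alpha> * slope (- ln \<bar>x\<bar>)))"

text \<open>The flow of \<open>hyp_field \<alpha>\<close>: time passes by translation in the clock
  coordinate.\<close>

definition time_map :: "real \<Rightarrow> real \<Rightarrow> real \<Rightarrow> real" where
  "time_map \<alpha> t = lift (\<lambda>u. unclock \<alpha> (clock \<alpha> u + t))"

lemma time_map_deriv:
  assumes a: "\<bar>\<alpha>\<bar> \<le> 1"
  shows "((\<lambda>t. time_map \<alpha> t x) has_real_derivative hyp_field \<alpha> (time_map \<alpha> t x)) (at t)"
proof (cases "x = 0")
  case False
  have "((\<lambda>t. sgn x * exp (- unclock \<alpha> (clock \<alpha> (- ln \<bar>x\<bar>) + t))) has_real_derivative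
      sgn x * (exp (- unclock \<alpha> (clock \<alpha> (- ln \<bar>x\<bar>) + t)) *
        - (1 + \<alpha> * slope (unclock \<alpha> (clock \<alpha> (- ln \<bar>x\<bar>) + t))))) (at t)"
    by (auto intro!: derivative_eq_intros DERIV_chain2[OF unclock_deriv[OF a]])
  moreover have "- ln \<bar>time_map \<alpha> t x\<bar> = unclock \<alpha> (clock \<alpha> (- ln \<bar>x\<bar>) + t)"
    using False by (simp add: time_map_def abs_lift)
  ultimately show ?thesis
    unfolding hyp_field_def by (simp add: time_map_def lift_def algebra_simps)
qed (simp add: time_map_def hyp_field_def)

text \<open>The field points towards the origin: u increases along orbits, so \<bar>x\<bar>
  decreases and the neighbourhood \<bar>x\<bar> < e itself contains the orbits that start in
  it.\<close>

lemma time_one_germ_time_map: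
  assumes a: "\<bar>\<alpha>\<bar> \<le> 1"
  shows "time_one_germ (hyp_field \<alpha>) (time_map \<alpha> 1)"
  unfolding time_one_germ_def
proof (intro allI impI)
  fix e :: real assume "0 < e"
  then have "\<forall>\<^sub>F x in nhds (0::real). \<bar>x\<bar> < e"
    unfolding eventually_nhds_metric by (intro exI[of _ e]) simp
  then show "\<forall>\<^sub>F x in nhds 0. \<exists>\<phi>. \<phi> 0 = x \<and> \<phi> 1 = time_map \<alpha> 1 x \<and>
        (\<forall>t\<in>{0..1}. \<bar>\<phi> t\<bar> < e \<and> (\<phi> has_real_derivative hyp_field \<alpha> (\<phi> t)) (at t within {0..1}))"
  proof eventually_elim
    case (elim x)
    have "\<bar>time_map \<alpha> t x\<bar> < e" if "0 \<le> t" for t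
    proof (cases "x = 0")
      case False
      have "unclock \<alpha> (clock \<alpha> (- ln \<bar>x\<bar>)) \<le> unclock \<alpha> (clock \<alpha> (- ln \<bar>x\<bar>) + t)"
        using that by (simp add: unclock_le_iff[OF a])
      then have "- unclock \<alpha> (clock \<alpha> (- ln \<bar>x\<bar>) + t) \<le> ln \<bar>x\<bar>"
        using a by simp
      then have "\<bar>time_map \<alpha> t x\<bar> \<le> exp (ln \<bar>x\<bar>)"
        unfolding time_map_def abs_lift[OF False] exp_le_cancel_iff .
      then show ?thesis using elim False by simp
    qed (use \<open>0 < e\<close> in \<open>simp add: time_map_def\<close>)
    moreover have "time_map \<alpha> 0 x = x" using a by (simp add: time_map_def)
    ultimately show ?case
      using time_map_deriv[OF a, THEN has_field_derivative_at_within]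
      by (intro exI[of _ "\<lambda>t. time_map \<alpha> t x"]) auto
  qed
qed

text \<open>The linearization for \<alpha> followed by the inverse linearization for \<beta>. It
  conjugates the flows, and exchanging the parameters inverts it.\<close>

definition conj_map :: "real \<Rightarrow> real \<Rightarrow> real \<Rightarrow> real" where
  "conj_map \<alpha> \<beta> = lift (\<lambda>u. unclock \<beta> (clock \<alpha> u))"

lemma C1_germ_conj_map:
  assumes a: "\<bar>\<alpha>\<bar> \<le> 1" and b: "\<bar>\<beta>\<bar> \<le> 1"
  shows "C1_germ (conj_map \<alpha> \<beta>)"
  unfolding conj_map_def
proof (rule C1_germ_lift)
  let ?P' = "\<lambda>u. (1 + \<beta> * slope (unclock \<beta> (clock \<alpha> u))) * (1 / (1 + \<alpha> * slope u))"
  fix u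
  show "((\<lambda>u. unclock \<beta> (clock \<alpha> u)) has_real_derivative ?P' u) (at u)"
    by (rule DERIV_chain2[OF unclock_deriv[OF b] clock_deriv[OF a]])
  show "isCont ?P' u"
    using mult_slope_pos[OF a, of u]
    by (intro continuous_intros isCont_mult_slope[OF a]
        isCont_o2[OF isCont_o2[OF DERIV_isCont[OF clock_deriv[OF a]] isCont_unclock[OF b]] isCont_mult_slope[OF b]])
      auto
  have "(?P' \<longlongrightarrow> 1 * (1 / 1)) at_top"
    by (intro tendsto_intros mult_slope_tendsto[OF a]
       filterlim_compose[OF mult_slope_tendsto[OF b]
         filterlim_compose[OF unclock_at_top[OF b] clock_at_top[OF a]]]) auto
  then show "(?P' \<longlongrightarrow> 1) at_top" by simp
  show "((\<lambda>u. unclock \<beta> (clock \<alpha> u) - u) \<longlongrightarrow> 0) at_top"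
    using tendsto_add[OF filterlim_compose[OF unclock_asymp[OF b] clock_at_top[OF a]] clock_asymp[OF a]]
    by simp
qed

lemma C1_conjugate_time_map:
  assumes a: "\<bar>\<alpha>\<bar> \<le> 1" and b: "\<bar>\<beta>\<bar> \<le> 1"
  shows "C1_conjugate (time_map \<alpha> 1) (time_map \<beta> 1)"
  unfolding C1_conjugate_def C1_diffeo_germ_def germ_eq_def
  using a b
  by (intro exI[of _ "conj_map \<alpha> \<beta>"] exI[of _ "conj_map \<beta> \<alpha>"])
    (auto simp: C1_germ_conj_map, auto simp: conj_map_def time_map_def lift_lift)

subsection \<open>Absolute continuity\<close>

text \<open>Induction on the number of intervals: the one with the largest left end point is split
  off, and the others lie to its left, so b shrinks to that end point. The bound c stays fixed so
  that the monotonicity hypothesis survives the shrinking.\<close>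

lemma sum_increments_le:
  fixes g :: "real \<Rightarrow> real"
  assumes "finite D" "\<forall>(u, v)\<in>D. a \<le> u \<and> u \<le> v \<and> v \<le> b" "a \<le> b"
    and "\<forall>p\<in>D. \<forall>q\<in>D. p \<noteq> q \<longrightarrow> {fst p<..<snd p} \<inter> {fst q<..<snd q} = {}"
    and mono: "mono_on {a..c} g" and "b \<le> c"
  shows "(\<Sum>(u, v)\<in>D. g v - g u) \<le> g b - g a"
  using assms(1-4,6)
proof (induction "card D" arbitrary: D b)
  case 0
  then show ?case using monotone_onD[OF mono, of a b] by simp
next
  case (Suc n)
  note fin = \<open>finite D\<close>
  have g: "g x \<le> g y" if "a \<le> x" "x \<le> y" "y \<le> b" for x y
    using monotone_onD[OF mono] that \<open>b \<le> c\<close> by auto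
  have split: "(\<Sum>(u, v)\<in>D. g v - g u) = (g (snd p) - g (fst p)) + (\<Sum>(u, v)\<in>D - {p}. g v - g u)"
    if "p \<in> D" for p
    using sum.remove[OF fin that, of "\<lambda>(u, v). g v - g u"] by (simp add: case_prod_unfold)
  have ivl: "a \<le> fst p" "fst p \<le> snd p" "snd p \<le> b" if "p \<in> D" for p
    using Suc.prems(2) that by auto
  show ?case
  \<comment> \<open>A degenerate interval has empty interior, so disjointness does not prevent it
    from lying inside another interval. Such pairs contribute nothing and are removed first.\<close>
  proof (cases "\<exists>p\<in>D. fst p = snd p")
    case True
    then obtain p where p: "p \<in> D" "fst p = snd p" by blast
    have "(\<Sum>(u, v)\<in>D - {p}. g v - g u) \<le> g b - g a"
      using Suc.prems Suc.hyps(2) p by (intro Suc.hyps(1)) auto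
    then show ?thesis using split[OF p(1)] p(2) by simp
  next
    case False
    have "D \<noteq> {}" using Suc.hyps(2) by auto
    then obtain p where p: "p \<in> D" and p_max: "\<And>q. q \<in> D \<Longrightarrow> fst q \<le> fst p"
      using Max_in[of "fst ` D"] Max_ge[of "fst ` D"] fin by fastforce
    have left: "snd q \<le> fst p" if q: "q \<in> D - {p}" for q
    proof (rule ccontr)
      assume "\<not> snd q \<le> fst p"
      moreover have "fst p < snd p" using False p ivl[OF p] by fastforce
      ultimately obtain m where "fst p < m" "m < min (snd p) (snd q)"
        using dense[of "fst p" "min (snd p) (snd q)"] by auto
      then have "m \<in> {fst p<..<snd p} \<inter> {fst q<..<snd q}" using p_max[of q] q by auto
      then show False using Suc.prems(4) p q by blast
    qed
    have "(\<Sum>(u, v)\<in>D - {p}. g v - g u) \<le> g (fst p) - g a"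
    proof (rule Suc.hyps(1))
      show "n = card (D - {p})" using Suc.hyps(2) p fin by simp
      show "\<forall>(u, v)\<in>D - {p}. a \<le> u \<and> u \<le> v \<and> v \<le> fst p"
        using left ivl by fastforce
      show "fst p \<le> c" using ivl[OF p] \<open>b \<le> c\<close> by linarith
    qed (use Suc.prems fin ivl[OF p] in auto)
    moreover have "g (snd p) \<le> g b" using g ivl[OF p] by auto
    ultimately show ?thesis using split[OF p] by linarith
  qed
qed

text \<open>
  Truncate \<open>g\<close> at a high level: the excess has small total integral, and the truncated integrand
  contributes a Lipschitz function.
\<close>

lemma abs_cont_on_if_integral_bound:
  fixes f g :: "real \<Rightarrow> real"
  assumes "a \<le> b" and int: "g integrable_on {a..b}" and nonneg: "\<And>x. 0 \<le> g x"
    and bound: "\<And>u v. a \<le> u \<Longrightarrow> u \<le> v \<Longrightarrow> v \<le> b \<Longrightarrow> \<bar>f v - f u\<bar> \<le> integral {u..v} g"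
  shows "abs_cont_on a b f"
  unfolding abs_cont_on_def
proof (intro allI impI)
  fix e :: real assume e: "0 < e"
  have ac: "g absolutely_integrable_on {a..b}"
    using int nonneg by (intro nonnegative_absolutely_integrable_1) auto
  define t where "t n x = min (g x) (real n)" for n x
  have t_int: "t n integrable_on {a..b}" for n
    unfolding t_def[abs_def]
    by (intro set_lebesgue_integral_eq_integral(1) absolutely_integrable_min_1 ac
        absolutely_integrable_on_const) auto
  have sub: "h integrable_on {u..v}" if "h integrable_on {a..b}" "a \<le> u" "v \<le> b" for h :: "real \<Rightarrow> real" and u v
    using integrable_on_subinterval[OF that(1)] that(2,3) by auto
  have "(\<lambda>n. integral {a..b} (t n)) \<longlonglongrightarrow> integral {a..b} g"
  proof (rule dominated_convergence(2)[OF t_int int])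
    show "norm (t n x) \<le> g x" for n x using nonneg[of x] by (simp add: t_def)
    show "(\<lambda>n. t n x) \<longlonglongrightarrow> g x" for x
    proof (rule tendsto_eventually)
      obtain N where "g x \<le> real N" using real_arch_simple by blast
      then show "\<forall>\<^sub>F n in sequentially. t n x = g x"
        unfolding t_def by (intro eventually_sequentiallyI[of N]) auto
    qed
  qed
  then have "\<forall>\<^sub>F n in sequentially. integral {a..b} g - e / 2 < integral {a..b} (t n)"
    using e by (intro order_tendstoD(1)) auto
  then obtain n where n: "integral {a..b} g - e / 2 < integral {a..b} (t n)"
    by (auto simp: eventually_sequentially)
  define r where "r x = g x - t n x" for x
  define \<Phi> where "\<Phi> x = integral {a..x} r" for x
  have r_int: "r integrable_on {a..b}" unfolding r_def[abs_def] by (intro integrable_diff int t_int)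
  have r_nonneg: "0 \<le> r x" for x by (simp add: r_def t_def)
  have \<Phi>_diff: "\<Phi> v - \<Phi> u = integral {u..v} r" if "a \<le> u" "u \<le> v" "v \<le> b" for u v
    using Henstock_Kurzweil_Integration.integral_combine[OF that(1,2) sub[OF r_int]] that
    by (simp add: \<Phi>_def)
  have incr: "\<bar>f v - f u\<bar> \<le> (\<Phi> v - \<Phi> u) + real n * (v - u)" if uv: "a \<le> u" "u \<le> v" "v \<le> b" for u v
  proof -
    have "integral {u..v} g = integral {u..v} r + integral {u..v} (t n)"
      using integral_add[OF sub[OF r_int uv(1,3)] sub[OF t_int[of n] uv(1,3)]] by (simp add: r_def[abs_def])
    also have "integral {u..v} (t n) \<le> integral {u..v} (\<lambda>_. real n)"
      by (intro integral_le sub[OF t_int uv(1,3)]) (auto simp: t_def)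
    finally show ?thesis using bound[OF uv] \<Phi>_diff[OF uv] uv by (simp add: mult.commute)
  qed
  have mono: "mono_on {a..b} \<Phi>"
  proof (rule mono_onI)
    fix u v assume "u \<in> {a..b}" "v \<in> {a..b}" "u \<le> v"
    then have "0 \<le> \<Phi> v - \<Phi> u"
      using \<Phi>_diff[of u v] r_nonneg sub[OF r_int, of u v]
      by (simp add: Henstock_Kurzweil_Integration.integral_nonneg)
    then show "\<Phi> u \<le> \<Phi> v" by simp
  qed
  have total: "\<Phi> b - \<Phi> a < e / 2"
    using n \<Phi>_diff[of a b] \<open>a \<le> b\<close> integral_diff[OF int t_int[of n]] by (simp add: r_def[abs_def])
  \<comment> \<open>The part with Lipschitz constant n then contributes at most e / 2; the summand 1
    covers n = 0.\<close>
  define d where "d = e / (2 * (real n + 1))"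
  show "\<exists>d>0. \<forall>D. finite D \<and> (\<forall>(u, v)\<in>D. a \<le> u \<and> u \<le> v \<and> v \<le> b) \<and>
        (\<forall>p\<in>D. \<forall>q\<in>D. p \<noteq> q \<longrightarrow> {fst p<..<snd p} \<inter> {fst q<..<snd q} = {}) \<and>
        (\<Sum>(u, v)\<in>D. v - u) < d \<longrightarrow> (\<Sum>(u, v)\<in>D. \<bar>f v - f u\<bar>) < e"
  proof (intro exI[of _ d] conjI allI impI; (elim conjE)?)
    show "0 < d" using e by (simp add: d_def)
    fix D :: "(real \<times> real) set"
    assume D: "finite D" "\<forall>(u, v)\<in>D. a \<le> u \<and> u \<le> v \<and> v \<le> b"
      "\<forall>p\<in>D. \<forall>q\<in>D. p \<noteq> q \<longrightarrow> {fst p<..<snd p} \<inter> {fst q<..<snd q} = {}"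
      and len: "(\<Sum>(u, v)\<in>D. v - u) < d"
    have "(\<Sum>(u, v)\<in>D. \<bar>f v - f u\<bar>) \<le> (\<Sum>(u, v)\<in>D. (\<Phi> v - \<Phi> u) + real n * (v - u))"
      using D(2) incr by (intro sum_mono) auto
    also have "\<dots> = (\<Sum>(u, v)\<in>D. \<Phi> v - \<Phi> u) + real n * (\<Sum>(u, v)\<in>D. v - u)"
      by (simp add: case_prod_unfold sum.distrib sum_distrib_left)
    also have "(\<Sum>(u, v)\<in>D. \<Phi> v - \<Phi> u) \<le> \<Phi> b - \<Phi> a"
      by (rule sum_increments_le[OF D(1,2) \<open>a \<le> b\<close> D(3) mono order_refl])
    also have "real n * (\<Sum>(u, v)\<in>D. v - u) \<le> real n * d"
      using len by (intro mult_left_mono) auto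
    also have "real n * d \<le> e / 2" using e by (simp add: d_def field_simps)
    finally show "(\<Sum>(u, v)\<in>D. \<bar>f v - f u\<bar>) < e" using total by simp
  qed
qed

subsection \<open>Regularity of the path\<close>

text \<open>The direction of the affine path. Within \<open>radius\<close>, \<open>pert1\<close> is
  its derivative and, away from 0, \<open>pert2\<close> its second derivative.\<close>

definition pert :: "real \<Rightarrow> real" where
  "pert x = x * slope (- ln \<bar>x\<bar>)"

definition pert1 :: "real \<Rightarrow> real" where
  "pert1 x = wave1 (- ln \<bar>x\<bar>) - wave2 (- ln \<bar>x\<bar>)"

definition pert2 :: "real \<Rightarrow> real" where
  "pert2 x = (wave3 (- ln \<bar>x\<bar>) - wave2 (- ln \<bar>x\<bar>)) / x"

text \<open>An integrable majorant of the second derivative. The constant 16 rounds up 35 / 4 + 7,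
  coming from 35 / u^3 + 7 / u^2 with u \<ge> 4. At 0 division by zero gives the value 0.\<close>

definition dominant :: "real \<Rightarrow> real" where
  "dominant x = 16 / (\<bar>x\<bar> * (ln \<bar>x\<bar>)\<^sup>2)"

text \<open>For 0 < \<bar>x\<bar> \<le> \<open>radius\<close> one has u \<ge> 5, strictly above the
  freezing level 4, so \<open>slope\<close> coincides with \<open>wave1\<close> on a neighbourhood
  of u.\<close>

definition radius :: real where
  "radius = exp (- 5)"

lemma radius_pos [simp]: "0 < radius" "0 \<le> radius"
  by (simp_all add: radius_def)

text \<open>The conventions for \<open>ln 0\<close> and for division by zero produce 0, which is the
  correct derivative of \<open>pert\<close> at the origin.\<close>

lemma pert1_0 [simp]: "pert1 0 = 0"
  by (simp add: pert1_def wave1_def wave2_def)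

lemma minus_ln_gt_4: "x \<noteq> 0 \<Longrightarrow> \<bar>x\<bar> \<le> radius \<Longrightarrow> 4 < - ln \<bar>x\<bar>"
  using ln_mono[of "\<bar>x\<bar>" radius] by (simp add: radius_def)

lemma minus_ln_abs_deriv: "x \<noteq> 0 \<Longrightarrow> ((\<lambda>x. - ln \<bar>x\<bar>) has_real_derivative - (1 / x)) (at x)"
proof -
  assume x: "x \<noteq> 0"
  define s where "s = sgn x"
  have s: "s * s = 1" "0 < s * x" using x by (auto simp: s_def sgn_if)
  then have "((\<lambda>y. - ln (s * y)) has_real_derivative - (1 / x)) (at x)"
    using x by (auto intro!: derivative_eq_intros)
  then show ?thesis
  proof (rule has_field_derivative_transform_within_open)
    show "open {y. 0 < s * y}" by (intro open_Collect_less continuous_intros)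
    show "x \<in> {y. 0 < s * y}" using s by simp
    show "- ln (s * y) = - ln \<bar>y\<bar>" if "y \<in> {y. 0 < s * y}" for y
      using that x by (auto simp: s_def sgn_if split: if_splits)
  qed
qed

lemma pert_deriv:
  assumes "\<bar>x\<bar> \<le> radius"
  shows "(pert has_real_derivative pert1 x) (at x)"
proof (cases "x = 0")
  case True
  have "((\<lambda>x. slope (- ln \<bar>x\<bar>)) \<longlongrightarrow> 0) (at 0)"
    by (rule filterlim_compose[OF slope_tendsto filterlim_minus_ln_abs])
  then have "((\<lambda>x. pert x / x) \<longlongrightarrow> 0) (at 0)"
    by (rule Lim_transform_eventually) (auto simp: eventually_at_filter pert_def intro!: always_eventually)
  then show ?thesis using True by (simp add: has_field_derivative_iff pert_def)
next
  case False
  let ?u = "- ln \<bar>x\<bar>"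
  have u: "4 < ?u" using minus_ln_gt_4 False assms by blast
  have "(slope has_real_derivative wave2 ?u) (at ?u)"
  proof (rule has_field_derivative_transform_within_open)
    show "(wave1 has_real_derivative wave2 ?u) (at ?u)" using u by (intro wave_derivs) auto
    show "open {4::real<..}" "?u \<in> {4<..}" using u by auto
  qed (simp add: slope_def max_absorb2)
  from DERIV_chain2[OF this minus_ln_abs_deriv[OF False]]
  have "((\<lambda>x. x * slope (- ln \<bar>x\<bar>)) has_real_derivative pert1 x) (at x)"
    using False u by (auto intro!: derivative_eq_intros simp: pert1_def slope_def max_absorb2)
  then show ?thesis by (simp add: pert_def[abs_def])
qed

lemma pert1_deriv:
  assumes "x \<noteq> 0" "\<bar>x\<bar> \<le> radius"
  shows "(pert1 has_real_derivative pert2 x) (at x)"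
proof -
  let ?u = "- ln \<bar>x\<bar>"
  have u: "1 < ?u" using minus_ln_gt_4[OF assms] by simp
  have "((\<lambda>u. wave1 u - wave2 u) has_real_derivative wave2 ?u - wave3 ?u) (at ?u)"
    by (intro derivative_intros wave_derivs u)
  from DERIV_chain2[OF this minus_ln_abs_deriv[OF assms(1)]]
  show ?thesis
    unfolding pert1_def[abs_def] by (rule DERIV_cong) (simp add: pert2_def diff_divide_distrib)
qed

lemma wave_tendsto_0: "(wave1 \<longlongrightarrow> 0) at_top" "(wave2 \<longlongrightarrow> 0) at_top"
proof -
  show "(wave1 \<longlongrightarrow> 0) at_top"
    by (rule Lim_null_comparison[OF _ tendsto_divide_at_top[of 2]])
      (auto intro!: eventually_at_top_linorderI[of 4] wave_bounds)
  have "\<bar>wave2 u\<bar> \<le> 7 / u" if "4 \<le> u" for u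
  proof -
    have "7 / u^2 \<le> 7 / u" using that by (intro divide_left_mono) (auto simp: power2_eq_square)
    then show ?thesis using wave_bounds(3)[OF that] by linarith
  qed
  then show "(wave2 \<longlongrightarrow> 0) at_top"
    by (intro Lim_null_comparison[OF _ tendsto_divide_at_top[of 7]])
      (auto intro!: eventually_at_top_linorderI[of 4])
qed

lemma isCont_pert1:
  assumes "\<bar>x\<bar> \<le> radius"
  shows "isCont pert1 x"
proof (cases "x = 0")
  case True
  have "((\<lambda>u. wave1 u - wave2 u) \<longlongrightarrow> 0) at_top"
    using tendsto_diff[OF wave_tendsto_0] by simp
  from filterlim_compose[OF this filterlim_minus_ln_abs] show ?thesis
    using True by (simp add: isCont_def pert1_def[abs_def] wave1_def wave2_def)
qed (use pert1_deriv assms DERIV_isCont in blast)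

lemma pert_bounds:
  assumes "\<bar>x\<bar> \<le> radius"
  shows "\<bar>pert x\<bar> \<le> 1" "\<bar>pert1 x\<bar> \<le> 1" "\<bar>pert2 x\<bar> \<le> dominant x"
proof -
  have "radius \<le> 1" by (simp add: radius_def)
  then show "\<bar>pert x\<bar> \<le> 1"
    using mult_mono[of "\<bar>x\<bar>" 1 "\<bar>slope (- ln \<bar>x\<bar>)\<bar>" "1/2"] slope_bounds(1) assms
    by (simp add: pert_def abs_mult)
  define u where "u = - ln \<bar>x\<bar>"
  have u: "4 < u" if "x \<noteq> 0" using minus_ln_gt_4[OF that assms] by (simp add: u_def)
  show "\<bar>pert1 x\<bar> \<le> 1"
  proof (cases "x = 0")
    case False
    have "16 \<le> u^2" using power_mono[of 4 u 2] u[OF False] by simp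
    then have "7 / u^2 \<le> 7 / 16" by (intro divide_left_mono) auto
    moreover have "2 / u \<le> 2 / 4" using u[OF False] by (intro divide_left_mono) auto
    ultimately have "\<bar>wave1 u - wave2 u\<bar> \<le> 1"
      using wave_bounds(2,3)[of u] u[OF False] by linarith
    then show ?thesis by (simp add: pert1_def u_def)
  qed simp
  show "\<bar>pert2 x\<bar> \<le> dominant x"
  proof (cases "x = 0")
    case False
    note u = u[OF False]
    have "35 / u^3 = (35 / u) / u^2" using u by (simp add: field_simps eval_nat_numeral)
    also have "\<dots> \<le> (35 / 4) / u^2"
      using u by (intro divide_right_mono divide_left_mono) auto
    finally have "35 / u^3 + 7 / u^2 \<le> (35 / 4) / u^2 + 7 / u^2" by simp
    also have "\<dots> = (35 / 4 + 7) / u^2" by (simp add: add_divide_distrib)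
    also have "\<dots> \<le> 16 / u^2" using u by (intro divide_right_mono) auto
    finally have "\<bar>wave3 u - wave2 u\<bar> \<le> 16 / u^2"
      using wave_bounds(3,4)[of u] u by linarith
    then have "\<bar>pert2 x\<bar> \<le> (16 / u^2) / \<bar>x\<bar>"
      unfolding pert2_def u_def abs_divide by (rule divide_right_mono) simp
    then show ?thesis by (simp add: dominant_def u_def mult.commute)
  qed (simp add: pert2_def dominant_def)
qed

lemma dominant_nonneg: "0 \<le> dominant x"
  by (simp add: dominant_def)

text \<open>An explicit antiderivative is 16 sgn x / (- ln \<bar>x\<bar>); the sign makes its
  derivative positive on both sides. It is continuous at 0 with value 0, so the fundamental theorem
  applies with the origin as exceptional point.\<close>

lemma dominant_integrable: "dominant integrable_on {-radius..radius}"
proof -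
  let ?G = "\<lambda>x::real. 16 * sgn x / - ln \<bar>x\<bar>"
  have d: "(?G has_real_derivative dominant x) (at x)" if "x \<in> {-radius..radius} - {0}" for x
  proof -
    define s where "s = sgn x"
    have "x \<noteq> 0" "\<bar>x\<bar> \<le> radius" using that by auto
    then have u: "4 < - ln \<bar>x\<bar>" by (rule minus_ln_gt_4)
    have "((\<lambda>x. 16 * s * inverse (- ln \<bar>x\<bar>)) has_real_derivative
        16 * s * - (inverse (- ln \<bar>x\<bar>) * - (1 / x) * inverse (- ln \<bar>x\<bar>))) (at x)"
      using u by (intro DERIV_cmult DERIV_inverse' minus_ln_abs_deriv \<open>x \<noteq> 0\<close>) auto
    moreover have "16 * s * - (inverse (- ln \<bar>x\<bar>) * - (1 / x) * inverse (- ln \<bar>x\<bar>)) = dominant x"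
      using \<open>x \<noteq> 0\<close> by (simp add: dominant_def s_def sgn_if field_simps power2_eq_square)
    ultimately have "((\<lambda>x. 16 * s / - ln \<bar>x\<bar>) has_real_derivative dominant x) (at x)"
      by (simp add: divide_inverse)
    then show ?thesis
    proof (rule has_field_derivative_transform_within_open)
      show "open {y. 0 < s * y}" by (intro open_Collect_less continuous_intros)
      show "x \<in> {y. 0 < s * y}" using \<open>x \<noteq> 0\<close> by (simp add: s_def sgn_if)
      show "16 * s / - ln \<bar>y\<bar> = ?G y" if "y \<in> {y. 0 < s * y}" for y
        using that \<open>x \<noteq> 0\<close> by (auto simp: s_def sgn_if split: if_splits)
    qed
  qed
  have "((\<lambda>x. 16 / - ln \<bar>x\<bar>) \<longlongrightarrow> 0) (at (0::real))"
    by (rule filterlim_compose[OF tendsto_divide_at_top filterlim_minus_ln_abs])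
  then have "(?G \<longlongrightarrow> 0) (at 0)"
    by (rule Lim_null_comparison[rotated, OF tendsto_rabs_zero])
      (auto simp: abs_mult abs_sgn_eq intro!: always_eventually)
  then have "isCont ?G 0" by (simp add: isCont_def)
  then have "isCont ?G x" if "x \<in> {-radius..radius}" for x
    using d[of x] that DERIV_isCont by (cases "x = 0") blast+
  then have "continuous_on {-radius..radius} ?G" by (simp add: continuous_at_imp_continuous_on)
  then have "(dominant has_integral (?G radius - ?G (-radius))) {-radius..radius}"
    using d radius_pos
    by (intro fundamental_theorem_of_calculus_strong[of "{0}"])
      (auto simp: has_real_derivative_iff_has_vector_derivative simp del: radius_pos)
  then show ?thesis by (rule has_integral_integrable)
qed

text \<open>The fundamental theorem again allows the origin as exceptional point, since
  \<open>pert1\<close> is continuous there although \<open>pert2\<close> is unbounded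
  nearby.\<close>

lemma pert1_increment:
  assumes "-radius \<le> u" "u \<le> v" "v \<le> radius"
  shows "\<bar>pert1 v - pert1 u\<bar> \<le> integral {u..v} dominant"
proof -
  have "(pert2 has_integral (pert1 v - pert1 u)) {u..v}"
  proof (rule fundamental_theorem_of_calculus_strong[of "{0}"])
    show "continuous_on {u..v} pert1"
      using assms by (intro continuous_at_imp_continuous_on ballI isCont_pert1) auto
    show "(pert1 has_vector_derivative pert2 x) (at x)" if "x \<in> {u..v} - {0}" for x
      using pert1_deriv[of x] that assms by (auto simp: has_real_derivative_iff_has_vector_derivative abs_le_iff)
  qed (use assms in auto)
  moreover have "norm (integral {u..v} pert2) \<le> integral {u..v} dominant"
  proof (rule integral_norm_bound_integral)
    show "pert2 integrable_on {u..v}" using calculation by (rule has_integral_integrable)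
    show "dominant integrable_on {u..v}"
      using integrable_on_subinterval[OF dominant_integrable] assms by auto
    show "norm (pert2 x) \<le> dominant x" if "x \<in> {u..v}" for x
      using pert_bounds(3)[of x] that assms by (auto simp: abs_le_iff)
  qed
  ultimately show ?thesis by (simp add: integral_unique)
qed

section \<open>The norm and the continuity of the path\<close>

lemma deriv_on_eq:
  assumes "(f has_real_derivative d) (at x within {a..b})" "a < b" "x \<in> {a..b}"
  shows "deriv_on a b f x = d"
  unfolding deriv_on_def
  using assms by (intro vector_derivative_within_closed_interval)
    (auto simp: has_real_derivative_iff_has_vector_derivative)

lemma hyp_field_eq: "hyp_field \<alpha> x = - (x + \<alpha> * pert x)"
  by (simp add: hyp_field_def pert_def algebra_simps)

lemma hyp_field_deriv:
  assumes "\<bar>x\<bar> \<le> radius"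
  shows "(hyp_field \<alpha> has_real_derivative - (1 + \<alpha> * pert1 x)) (at x)"
  unfolding hyp_field_eq[abs_def] using assms by (auto intro!: derivative_eq_intros pert_deriv)

lemma hyperbolic_germ_hyp_field: "hyperbolic_germ (hyp_field \<alpha>)"
  unfolding hyperbolic_germ_def
proof (intro conjI)
  show "C1_germ (hyp_field \<alpha>)"
    unfolding C1_germ_def C1_differentiable_on_def
  proof (intro exI[of _ radius] conjI exI[of _ "\<lambda>x. - (1 + \<alpha> * pert1 x)"] ballI)
    show "continuous_on {-radius<..<radius} (\<lambda>x. - (1 + \<alpha> * pert1 x))"
      by (intro continuous_at_imp_continuous_on ballI continuous_intros isCont_pert1) auto
    show "(hyp_field \<alpha> has_vector_derivative - (1 + \<alpha> * pert1 x)) (at x)" if "x \<in> {-radius<..<radius}" for x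
      using hyp_field_deriv[of x] that by (auto simp: has_real_derivative_iff_has_vector_derivative)
  qed simp
  show "hyp_field \<alpha> 0 = 0" by (simp add: hyp_field_def)
  have "deriv (hyp_field \<alpha>) 0 = -1" using DERIV_imp_deriv[OF hyp_field_deriv[of 0 \<alpha>]] radius_pos by simp
  then show "deriv (hyp_field \<alpha>) 0 \<noteq> 0" by simp
qed

lemma C1ac_on_hyp_field:
  assumes "\<bar>\<alpha>\<bar> \<le> 1"
  shows "C1ac_on (-radius) radius (hyp_field \<alpha>)"
proof -
  have d: "(hyp_field \<alpha> has_real_derivative - (1 + \<alpha> * pert1 x)) (at x within {-radius..radius})"
    if "x \<in> {-radius..radius}" for x
    by (rule has_field_derivative_at_within[OF hyp_field_deriv]) (use that in auto)
  have e: "deriv_on (-radius) radius (hyp_field \<alpha>) x = - (1 + \<alpha> * pert1 x)" if "x \<in> {-radius..radius}" for x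
    by (rule deriv_on_eq[OF d[OF that] _ that]) simp
  show ?thesis
    unfolding C1ac_on_def
  proof (intro conjI)
    show "hyp_field \<alpha> differentiable_on {-radius..radius}"
      unfolding differentiable_on_def using d real_differentiable_def by blast
    have "continuous_on {-radius..radius} (\<lambda>x. - (1 + \<alpha> * pert1 x))"
      by (intro continuous_at_imp_continuous_on ballI continuous_intros isCont_pert1) auto
    then show "continuous_on {-radius..radius} (deriv_on (-radius) radius (hyp_field \<alpha>))"
      by (rule continuous_on_eq) (simp add: e)
    show "abs_cont_on (-radius) radius (deriv_on (-radius) radius (hyp_field \<alpha>))"
    proof (rule abs_cont_on_if_integral_bound[OF _ dominant_integrable dominant_nonneg])
      show "-radius \<le> radius" by simp
      fix u v assume uv: "-radius \<le> u" "u \<le> v" "v \<le> radius"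
      have "deriv_on (-radius) radius (hyp_field \<alpha>) v - deriv_on (-radius) radius (hyp_field \<alpha>) u
          = - \<alpha> * (pert1 v - pert1 u)"
        using uv by (simp add: e algebra_simps)
      also have "\<bar>\<dots>\<bar> \<le> 1 * \<bar>pert1 v - pert1 u\<bar>"
        unfolding abs_mult using assms by (intro mult_right_mono) auto
      finally show "\<bar>deriv_on (-radius) radius (hyp_field \<alpha>) v - deriv_on (-radius) radius (hyp_field \<alpha>) u\<bar>
          \<le> integral {u..v} dominant"
        using pert1_increment[OF uv] by simp
    qed
  qed
qed

text \<open>The summand 2 collects the two sup norms, each at most \<bar>c\<bar>. Linearity of the
  bound in \<bar>c\<bar> gives continuity of the affine path.\<close>

lemma C1ac_norm_pert_le:
  "C1ac_norm radius (\<lambda>x. c * pert x) \<le> ennreal (\<bar>c\<bar> * (2 + integral {-radius..radius} dominant))"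
proof -
  let ?I = "{-radius..radius}"
  have ab: "-radius < radius" by simp
  have x: "x \<in> ?I \<longleftrightarrow> \<bar>x\<bar> \<le> radius" for x by auto
  have e1: "deriv_on (-radius) radius (\<lambda>x. c * pert x) x = c * pert1 x" if "x \<in> ?I" for x
    by (rule deriv_on_eq[OF has_field_derivative_at_within[OF DERIV_cmult[OF pert_deriv]] ab that])
      (use that in \<open>simp only: x\<close>)
  have e2: "deriv_on (-radius) radius (deriv_on (-radius) radius (\<lambda>x. c * pert x)) x = c * pert2 x"
    if "x \<in> ?I" "x \<noteq> 0" for x
  proof (rule deriv_on_eq[OF _ ab that(1)])
    have "((\<lambda>x. c * pert1 x) has_real_derivative c * pert2 x) (at x within ?I)"
      by (rule has_field_derivative_at_within[OF DERIV_cmult[OF pert1_deriv]])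
        (use that x[of x] in blast)+
    then show "(deriv_on (-radius) radius (\<lambda>x. c * pert x) has_real_derivative c * pert2 x) (at x within ?I)"
      by (rule has_field_derivative_transform_within[OF _ zero_less_one that(1)]) (simp add: e1)
  qed
  let ?J = "integral ?I dominant"
  have J: "0 \<le> ?J" by (intro Henstock_Kurzweil_Integration.integral_nonneg dominant_integrable dominant_nonneg)
  have "(SUP x\<in>?I. ennreal \<bar>c * pert x\<bar>) \<le> ennreal \<bar>c\<bar>"
    using pert_bounds(1) mult_left_mono[of _ 1 "\<bar>c\<bar>"]
    by (intro SUP_least ennreal_leI) (auto simp: x abs_mult)
  moreover have "(SUP x\<in>?I. ennreal \<bar>deriv_on (-radius) radius (\<lambda>x. c * pert x) x\<bar>) \<le> ennreal \<bar>c\<bar>"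
    using pert_bounds(2) mult_left_mono[of _ 1 "\<bar>c\<bar>"]
    by (intro SUP_least ennreal_leI) (auto simp: e1 x abs_mult)
  moreover have "(\<integral>\<^sup>+x\<in>?I. ennreal \<bar>deriv_on (-radius) radius
      (deriv_on (-radius) radius (\<lambda>x. c * pert x)) x\<bar> \<partial>lebesgue) \<le> ennreal (\<bar>c\<bar> * ?J)"
  proof -
    have "(\<integral>\<^sup>+x\<in>?I. ennreal \<bar>deriv_on (-radius) radius
        (deriv_on (-radius) radius (\<lambda>x. c * pert x)) x\<bar> \<partial>lebesgue)
      \<le> (\<integral>\<^sup>+x\<in>?I. ennreal (\<bar>c\<bar> * dominant x) \<partial>lebesgue)"
    proof (rule nn_integral_mono_AE)
      \<comment> \<open>The iterated derivative was identified only for x \<noteq> 0; a single point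
        does not affect the integral.\<close>
      have "AE x in lebesgue. x \<notin> {0::real}"
        by (rule AE_not_in) (simp add: negligible_iff_null_sets[symmetric])
      then show "AE x in lebesgue. ennreal \<bar>deriv_on (-radius) radius
          (deriv_on (-radius) radius (\<lambda>x. c * pert x)) x\<bar> * indicator ?I x
          \<le> ennreal (\<bar>c\<bar> * dominant x) * indicator ?I x"
      proof (rule AE_mp, intro AE_I2 impI)
        fix x :: real assume "x \<notin> {0}"
        then show "ennreal \<bar>deriv_on (-radius) radius
          (deriv_on (-radius) radius (\<lambda>x. c * pert x)) x\<bar> * indicator ?I x
          \<le> ennreal (\<bar>c\<bar> * dominant x) * indicator ?I x"
          using pert_bounds(3)[of x]
          by (cases "x \<in> ?I") (auto simp: e2 x abs_mult intro!: ennreal_leI mult_left_mono)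
      qed
    qed
    also have "\<dots> = ennreal (\<bar>c\<bar> * ?J)"
      unfolding nn_integral_completion
      by (rule nn_integral_has_integral_lebesgue')
        (auto simp: dominant_nonneg intro!: has_integral_mult_right integrable_integral dominant_integrable)
    finally show ?thesis .
  qed
  ultimately have "C1ac_norm radius (\<lambda>x. c * pert x) \<le> ennreal \<bar>c\<bar> + ennreal \<bar>c\<bar> + ennreal (\<bar>c\<bar> * ?J)"
    unfolding C1ac_norm_def by (intro add_mono)
  also have "\<dots> = ennreal (\<bar>c\<bar> * (2 + ?J))"
    using J by (simp add: ennreal_plus[symmetric] algebra_simps del: ennreal_plus)
  finally show ?thesis .
qed

lemma C1ac_continuous_path_hyp_field: "C1ac_continuous_path {-1..1} hyp_field"
  unfolding C1ac_continuous_path_def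
proof (intro conjI exI[of _ radius] exI[of _ hyp_field] ballI)
  show "is_interval {-1..1::real}" by (simp add: is_interval_cc)
  show "\<exists>a\<in>{-1..1}. \<exists>b\<in>{-1..1}. a < (b::real)"
    by (intro bexI[of _ 0] bexI[of _ 1]) auto
  fix \<alpha> :: real assume "\<alpha> \<in> {-1..1}"
  then show "C1ac_on (-radius) radius (hyp_field \<alpha>)" by (intro C1ac_on_hyp_field) auto
  let ?K = "2 + integral {-radius..radius} dominant"
  have "((\<lambda>\<beta>. ennreal (\<bar>\<alpha> - \<beta>\<bar> * ?K)) \<longlongrightarrow> ennreal (\<bar>\<alpha> - \<alpha>\<bar> * ?K)) (at \<alpha> within {-1..1})"
    by (intro tendsto_ennrealI tendsto_intros)
  then have lim: "((\<lambda>\<beta>. ennreal (\<bar>\<alpha> - \<beta>\<bar> * ?K)) \<longlongrightarrow> 0) (at \<alpha> within {-1..1})" by simp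
  \<comment> \<open>The path is affine, so this difference is exactly
    \<open>(\<alpha> - \<beta>) * pert x\<close>.\<close>
  have "C1ac_norm radius (\<lambda>x. hyp_field \<beta> x - hyp_field \<alpha> x) \<le> ennreal (\<bar>\<alpha> - \<beta>\<bar> * ?K)" for \<beta>
    using C1ac_norm_pert_le[of "\<alpha> - \<beta>"] by (simp add: hyp_field_eq algebra_simps)
  then show "((\<lambda>\<beta>. C1ac_norm radius (\<lambda>x. hyp_field \<beta> x - hyp_field \<alpha> x)) \<longlongrightarrow> 0) (at \<alpha> within {-1..1})"
    by (intro tendsto_sandwich[OF _ _ tendsto_const lim]) auto
qed (auto simp: germ_eq_def)

subsection \<open>Conjugacies between the time-1 maps\<close>

text \<open>Iteration shows that g z / z has the same value at all points z = l^n * y, while it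
  tends to D as these points approach 0.\<close>

lemma linear_if_commutes_with_scaling:
  fixes g :: "real \<Rightarrow> real"
  assumes d: "(g has_real_derivative D) (at 0)" and g0: "g 0 = 0"
    and l: "0 < l" "l < 1" and comm: "\<And>y. \<bar>y\<bar> < r \<Longrightarrow> g (l * y) = l * g y"
    and y: "\<bar>y\<bar> < r"
  shows "g y = D * y"
proof (cases "y = 0")
  case False
  have small: "\<bar>l ^ n * y\<bar> < r" for n
  proof -
    have "l ^ n * \<bar>y\<bar> \<le> 1 * \<bar>y\<bar>" using l by (intro mult_right_mono power_le_one) auto
    then show ?thesis using y l by (simp add: abs_mult)
  qed
  have iter: "g (l ^ n * y) = l ^ n * g y" for n
  proof (induction n)
    case (Suc n)
    then show ?case using comm[OF small[of n]] by (simp add: mult.assoc)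
  qed simp
  have lim: "(\<lambda>n. l ^ n * y) \<longlonglongrightarrow> 0"
    using tendsto_mult_left_zero[OF LIMSEQ_power_zero[of l], of y] l by simp
  have "filterlim (\<lambda>n. l ^ n * y) (at 0) sequentially"
    unfolding filterlim_at using lim False l by simp
  moreover have "((\<lambda>y. g y / y) \<longlongrightarrow> D) (at 0)"
    using d g0 by (simp add: has_field_derivative_iff)
  ultimately have "(\<lambda>n. g (l ^ n * y) / (l ^ n * y)) \<longlonglongrightarrow> D" by (rule filterlim_compose[rotated])
  moreover have "g (l ^ n * y) / (l ^ n * y) = g y / y" for n
    unfolding iter using l by simp
  ultimately have "g y / y = D" by (simp add: LIMSEQ_const_iff)
  then show ?thesis using False by (simp add: field_simps)
qed (use g0 in simp)

lemma C1_germ_deriv_0: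
  assumes "C1_germ h"
  obtains D where "(h has_real_derivative D) (at 0)"
proof -
  obtain \<epsilon> D where "0 < \<epsilon>" and D: "\<forall>x\<in>{-\<epsilon><..<\<epsilon>}. (h has_vector_derivative D x) (at x)"
    using assms unfolding C1_germ_def C1_differentiable_on_def by blast
  then have "(h has_real_derivative D 0) (at 0)"
    by (simp add: has_real_derivative_iff_has_vector_derivative)
  then show ?thesis by (rule that)
qed

lemma eventually_compose_isCont:
  assumes "\<forall>\<^sub>F x in nhds 0. P x" "isCont f 0" "f 0 = (0::real)"
  shows "\<forall>\<^sub>F x in nhds (0::real). P (f x)"
proof -
  have "filterlim f (nhds 0) (nhds 0)"
    using assms(2,3) unfolding isCont_def tendsto_at_iff_tendsto_nhds by simp
  then show ?thesis using assms(1) by (simp add: filterlim_iff)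
qed

lemma lift_clock_deriv_0:
  assumes "\<bar>\<alpha>\<bar> \<le> 1"
  shows "(lift (clock \<alpha>) has_real_derivative 1) (at 0)"
    and "(lift (unclock \<alpha>) has_real_derivative 1) (at 0)"
  using lift_deriv_0[OF clock_asymp[OF assms]] lift_deriv_0[OF unclock_asymp[OF assms]] by simp_all

lemma exp_minus_1_mult_lift: "exp (-1) * lift P x = lift (\<lambda>u. P u + 1) x"
  by (simp add: lift_def exp_minus exp_diff exp_add field_simps)

text \<open>Read in the linearizing coordinates, h becomes a germ g commuting with multiplication by
  exp (-1), hence g y = D * y. Transported back, the factor D is a translation by - ln \<bar>D\<bar>
  of the clock, with a reflection if D < 0.\<close>

lemma conjugacy_form:
  assumes a: "\<bar>\<alpha>\<bar> \<le> 1" and b: "\<bar>\<beta>\<bar> \<le> 1"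
    and hk: "C1_diffeo_germ h k" and conj: "germ_eq (h \<circ> time_map \<alpha> 1 \<circ> k) (time_map \<beta> 1)"
  shows "\<exists>D. D \<noteq> 0 \<and>
    (\<forall>\<^sub>F x in nhds 0. h x = sgn D * lift (\<lambda>u. unclock \<beta> (clock \<alpha> u - ln \<bar>D\<bar>)) x)"
proof -
  have h0: "h 0 = 0" and k0: "k 0 = 0" and hC: "C1_germ h" and kC: "C1_germ k"
    and kh: "\<forall>\<^sub>F x in nhds 0. k (h x) = x"
    using hk by (auto simp: C1_diffeo_germ_def germ_eq_def)
  obtain D where D: "(h has_real_derivative D) (at 0)" using C1_germ_deriv_0[OF hC] .
  obtain E where E: "(k has_real_derivative E) (at 0)" using C1_germ_deriv_0[OF kC] .
  have "D \<noteq> 0"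
  proof
    assume "D = 0"
    have "((\<lambda>x. k (h x)) has_real_derivative E * D) (at 0)"
      using E D h0 by (intro DERIV_chain2) auto
    moreover have "((\<lambda>x. k (h x)) has_real_derivative 1) (at 0)"
      using DERIV_cong_ev[OF refl kh refl, of 1] DERIV_ident by blast
    ultimately show False using \<open>D = 0\<close> DERIV_unique by fastforce
  qed
  let ?T = "\<lambda>\<alpha>. lift (clock \<alpha>)" and ?S = "\<lambda>\<alpha>. lift (unclock \<alpha>)"
  define g where "g y = ?T \<beta> (h (?S \<alpha> y))" for y
  have ST: "?S \<alpha> (?T \<alpha> x) = x" "?S \<beta> (?T \<beta> x) = x" "?T \<alpha> (?S \<alpha> x) = x" for x
    using a b by (simp_all add: lift_lift)
  have "\<forall>\<^sub>F x in nhds 0. h (time_map \<alpha> 1 (k x)) = time_map \<beta> 1 x"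
    using conj by (simp add: germ_eq_def)
  from eventually_compose_isCont[OF this DERIV_isCont[OF D] h0] kh
  have "\<forall>\<^sub>F x in nhds 0. h (time_map \<alpha> 1 x) = time_map \<beta> 1 (h x)"
    by eventually_elim simp
  from eventually_compose_isCont[OF this DERIV_isCont[OF lift_clock_deriv_0(2)[OF a]] lift_0]
  have "\<forall>\<^sub>F y in nhds 0. g (exp (-1) * y) = exp (-1) * g y"
  proof eventually_elim
    case (elim y)
    have "exp (-1) * y = lift (\<lambda>u. u + 1) y"
      using exp_minus_1_mult_lift[of "\<lambda>u. u" y] by simp
    then have "?S \<alpha> (exp (-1) * y) = time_map \<alpha> 1 (?S \<alpha> y)"
      using a by (simp add: time_map_def lift_lift)
    then have "g (exp (-1) * y) = ?T \<beta> (time_map \<beta> 1 (h (?S \<alpha> y)))"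
      by (simp add: g_def elim)
    also have "\<dots> = exp (-1) * g y"
      using b by (simp add: g_def time_map_def lift_lift exp_minus_1_mult_lift)
    finally show ?case .
  qed
  then obtain r where r: "0 < r" "\<And>y. \<bar>y\<bar> < r \<Longrightarrow> g (exp (-1) * y) = exp (-1) * g y"
    unfolding eventually_nhds_metric by (auto simp: dist_real_def)
  \<comment> \<open>The lifted clocks have derivative 1 at 0, so g inherits the multiplier D of
    h.\<close>
  have "(g has_real_derivative 1 * (D * 1)) (at 0)"
    unfolding g_def[abs_def]
    using lift_clock_deriv_0(1)[OF b] lift_clock_deriv_0(2)[OF a] D h0
    by (intro DERIV_chain2[where f = "?T \<beta>"] DERIV_chain2[where f = h]) auto
  then have dg: "(g has_real_derivative D) (at 0)" by simp
  have g_lin: "g y = D * y" if "\<bar>y\<bar> < r" for y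
    by (rule linear_if_commutes_with_scaling[OF dg _ _ _ r(2) that]) (simp_all add: g_def h0)
  then have "\<forall>\<^sub>F y in nhds 0. g y = D * y"
    unfolding eventually_nhds_metric using r(1) by (auto simp: dist_real_def intro!: exI[of _ r])
  from eventually_compose_isCont[OF this DERIV_isCont[OF lift_clock_deriv_0(1)[OF a]] lift_0]
  have "\<forall>\<^sub>F x in nhds 0. h x = sgn D * lift (\<lambda>u. unclock \<beta> (clock \<alpha> u - ln \<bar>D\<bar>)) x"
  proof eventually_elim
    case (elim x)
    have "h x = ?S \<beta> (g (?T \<alpha> x))" by (simp add: g_def ST)
    also have "\<dots> = ?S \<beta> (sgn D * lift (\<lambda>u. clock \<alpha> u - ln \<bar>D\<bar>) x)"
      by (simp add: elim lift_scale[OF \<open>D \<noteq> 0\<close>])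
    finally show ?case by (simp add: lift_sgn_mult[OF \<open>D \<noteq> 0\<close>] lift_lift)
  qed
  then show ?thesis using \<open>D \<noteq> 0\<close> by blast
qed

section \<open>Asymptotics of the derivative of a conjugacy\<close>

lemma wave_lipschitz:
  assumes "4 \<le> m" "m \<le> x" "m \<le> y"
  shows "\<bar>wave x - wave y\<bar> \<le> 2 / m * \<bar>x - y\<bar>"
proof -
  have "norm (wave x - wave y) \<le> 2 / m * norm (x - y)"
  proof (rule field_differentiable_bound[of "{m..}"])
    fix z assume z: "z \<in> {m..}"
    then show "(wave has_real_derivative wave1 z) (at z within {m..})"
      using assms by (intro has_field_derivative_at_within[OF wave_derivs(1)]) auto
    have "2 / z \<le> 2 / m" using z assms by (intro divide_left_mono) auto
    then show "norm (wave1 z) \<le> 2 / m" using wave_bounds(2)[of z] z assms by simp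
  qed (use assms in auto)
  then show ?thesis by simp
qed

lemma abs_ln_one_plus_le:
  fixes x :: real
  assumes "\<bar>x\<bar> \<le> 1/2"
  shows "\<bar>ln (1 + x)\<bar> \<le> 2 * \<bar>x\<bar>"
proof -
  have "x\<^sup>2 \<le> 1/2 * \<bar>x\<bar>"
    using mult_right_mono[OF assms, of "\<bar>x\<bar>"] by (simp add: power2_eq_square)
  then show ?thesis using abs_ln_one_plus_x_minus_x_bound[OF assms] by linarith
qed

lemma abs_wave_le_1:
  assumes "4 \<le> u"
  shows "\<bar>wave u\<bar> \<le> 1"
proof -
  have "1 / ln u \<le> 1" using one_le_ln[OF assms] by simp
  then show ?thesis using wave_bounds(1)[OF assms] by linarith
qed

lemma ln_mult_slope_le:
  assumes a: "\<bar>\<alpha>\<bar> \<le> 1" and u: "4 \<le> u"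
  shows "\<bar>ln (1 + \<alpha> * slope u)\<bar> \<le> 4 / u"
proof -
  have "\<bar>\<alpha> * slope u\<bar> \<le> 1 * (2 / u)"
    unfolding abs_mult using slope_bounds(2)[OF u] a by (intro mult_mono) auto
  then show ?thesis using abs_ln_one_plus_le[OF mult_slope_bounds(1)[OF a, of u]] by simp
qed

text \<open>By \<open>lift_deriv\<close>, \<open>u - P u + ln (P' u)\<close> is the logarithm of the
  derivative of \<open>lift P\<close> at exp (- u). Comparing \<open>clock_approx\<close> at u and
  at P u expresses u - P u through the two waves; since u - P u is bounded and the wave has slope
  O(1 / u), wave (P u) may be replaced by wave u. The logarithm of P' is itself O(1 / u).\<close>

lemma transition_asymp:
  fixes c :: real
  assumes a: "\<bar>\<alpha>\<bar> \<le> 1" and b: "\<bar>\<beta>\<bar> \<le> 1"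
  defines "P \<equiv> \<lambda>u. unclock \<beta> (clock \<alpha> u - c)"
  defines "P' \<equiv> \<lambda>u. (1 + \<beta> * slope (P u)) / (1 + \<alpha> * slope u)"
  shows "\<exists>K>0. \<forall>\<^sub>F u in at_top. \<bar>(u - P u + ln (P' u)) - (c + (\<alpha> - \<beta>) * wave u)\<bar> \<le> K / u"
proof -
  \<comment> \<open>A bound for \<bar>u - P u\<bar>: the waves contribute at most 1 each and the
    remainders at most 8 / 4 each.\<close>
  define B where "B = \<bar>c\<bar> + 6"
  have "filterlim (\<lambda>u. clock \<alpha> u + - c) at_top at_top"
    by (rule filterlim_tendsto_add_at_top[OF tendsto_const clock_at_top[OF a], of "- c", unfolded add.commute[of "- c"]])
  then have "filterlim P at_top at_top"
    unfolding P_def using filterlim_compose[OF unclock_at_top[OF b]] by fastforce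
  then have "\<forall>\<^sub>F u in at_top. 4 \<le> P u" by (simp add: filterlim_at_top)
  \<comment> \<open>This gives u - B \<ge> u / 2 \<ge> 4, so both u and P u lie in the range {u /
    2..} on which the wave is Lipschitz with constant 4 / u.\<close>
  moreover have "\<forall>\<^sub>F u in at_top. 2 * B + 8 \<le> u" by (rule eventually_ge_at_top)
  ultimately have "\<forall>\<^sub>F u in at_top. \<bar>(u - P u + ln (P' u)) - (c + (\<alpha> - \<beta>) * wave u)\<bar> \<le> (36 + 4 * B) / u"
  proof eventually_elim
    case (elim u)
    have "0 \<le> B" by (simp add: B_def)
    then have u: "8 \<le> u" "4 \<le> u" using elim by auto
    define e1 where "e1 = (u - \<alpha> * wave u) - clock \<alpha> u"
    define e2 where "e2 = (P u - \<beta> * wave (P u)) - clock \<beta> (P u)"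
    have cP: "clock \<beta> (P u) = clock \<alpha> u - c" using b by (simp add: P_def)
    have diff: "u - P u = c + \<alpha> * wave u - \<beta> * wave (P u) + e1 - e2"
      by (simp add: e1_def e2_def cP)
    have e1: "\<bar>e1\<bar> \<le> 8 / u"
      using clock_approx[OF a u(2)] unfolding e1_def by (simp add: abs_minus_commute)
    have e2: "\<bar>e2\<bar> \<le> 8 / P u"
      using clock_approx[OF b elim(1)] unfolding e2_def by (simp add: abs_minus_commute)
    have w: "\<bar>\<alpha> * wave u\<bar> \<le> 1" "\<bar>\<beta> * wave (P u)\<bar> \<le> 1"
      using mult_mono[OF a abs_wave_le_1[OF u(2)]] mult_mono[OF b abs_wave_le_1[OF elim(1)]]
      by (simp_all add: abs_mult)
    have "8 / u \<le> 8 / 4" "8 / P u \<le> 8 / 4" using u elim by (intro divide_left_mono; simp)+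
    then have uP: "\<bar>u - P u\<bar> \<le> B"
      unfolding diff B_def using e1 e2 w by linarith
    then have half: "u / 2 \<le> P u" using elim by linarith
    have "8 / P u \<le> 8 / (u / 2)" using half u by (intro divide_left_mono) auto
    then have e2': "\<bar>e2\<bar> \<le> 16 / u" using e2 by simp
    have "\<bar>wave u - wave (P u)\<bar> \<le> 2 / (u / 2) * \<bar>u - P u\<bar>"
      using half u by (intro wave_lipschitz) auto
    also have "\<dots> \<le> 2 / (u / 2) * B" using uP u by (intro mult_left_mono) auto
    finally have wave: "\<bar>wave u - wave (P u)\<bar> \<le> 4 * B / u" by simp
    have "\<bar>\<beta> * (wave u - wave (P u))\<bar> \<le> 1 * (4 * B / u)"
      unfolding abs_mult using b wave by (intro mult_mono) auto
    then have bw: "\<bar>\<beta> * wave u - \<beta> * wave (P u)\<bar> \<le> 4 * B / u"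
      by (simp add: right_diff_distrib)
    have l1: "\<bar>ln (1 + \<alpha> * slope u)\<bar> \<le> 4 / u" by (rule ln_mult_slope_le[OF a u(2)])
    have "4 / P u \<le> 4 / (u / 2)" using half u by (intro divide_left_mono) auto
    then have l2: "\<bar>ln (1 + \<beta> * slope (P u))\<bar> \<le> 8 / u"
      using ln_mult_slope_le[OF b elim(1)] by simp
    have "ln (P' u) = ln (1 + \<beta> * slope (P u)) - ln (1 + \<alpha> * slope u)"
      using mult_slope_pos[OF a, of u] mult_slope_pos[OF b, of "P u"] by (simp add: P'_def ln_div)
    then have "(u - P u + ln (P' u)) - (c + (\<alpha> - \<beta>) * wave u)
      = (\<beta> * wave u - \<beta> * wave (P u)) + e1 - e2 + ln (1 + \<beta> * slope (P u)) - ln (1 + \<alpha> * slope u)"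
      by (simp add: diff left_diff_distrib)
    also have "\<bar>\<dots>\<bar> \<le> 4 * B / u + 8 / u + 16 / u + 8 / u + 4 / u"
      using bw e1 e2' l1 l2 by linarith
    also have "\<dots> = (36 + 4 * B) / u" by (simp add: add_divide_distrib)
    finally show ?case .
  qed
  then show ?thesis by (intro exI[of _ "36 + 4 * B"]) (auto simp: B_def)
qed

section \<open>Infinite variation along the crests of the wave\<close>

lemma summable_increments_if_abs_cont_on:
  fixes f :: "real \<Rightarrow> real"
  assumes ac: "abs_cont_on a b f" and dec: "\<And>n. x (Suc n) < x n" and ab: "\<And>n. x n \<in> {a..b}"
  shows "summable (\<lambda>n. \<bar>f (x n) - f (x (Suc n))\<bar>)"
proof -
  obtain d where "0 < d" and d: "\<And>D. finite D \<Longrightarrow> \<forall>(u, v)\<in>D. a \<le> u \<and> u \<le> v \<and> v \<le> b \<Longrightarrow>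
        \<forall>p\<in>D. \<forall>q\<in>D. p \<noteq> q \<longrightarrow> {fst p<..<snd p} \<inter> {fst q<..<snd q} = {} \<Longrightarrow>
        (\<Sum>(u, v)\<in>D. v - u) < d \<Longrightarrow> (\<Sum>(u, v)\<in>D. \<bar>f v - f u\<bar>) < 1"
    using ac[unfolded abs_cont_on_def, rule_format, of 1] by auto
  \<comment> \<open>A decreasing sequence in {a..b} converges, so from some index N on all terms lie
    within d of x N. The intervals between consecutive terms of this tail are disjoint with total
    length below d, which bounds all partial sums by 1.\<close>
  have decseq: "decseq x" using dec by (simp add: decseq_Suc_iff less_imp_le)
  have "\<forall>i. a \<le> x i" using ab by simp
  with decseq obtain L where "x \<longlonglongrightarrow> L" by (rule decseq_convergent)
  then have "Cauchy x" by (rule LIMSEQ_imp_Cauchy)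
  from metric_CauchyD[OF this \<open>0 < d\<close>]
  obtain N where N: "\<And>m. N \<le> m \<Longrightarrow> \<bar>x m - x N\<bar> < d"
    unfolding dist_real_def by blast
  define y where "y n = x (n + N)" for n
  have y_strict: "y n < y m" if "m < n" for m n
    using that
  proof (induction n)
    case (Suc n)
    have "y (Suc n) < y n" using dec by (simp add: y_def)
    then show ?case using Suc by (cases "m = n") auto
  qed simp
  have y_dec: "y n \<le> y m" if "m \<le> n" for m n
    using decseqD[OF decseq] that by (simp add: y_def)
  have "summable (\<lambda>n. \<bar>f (y n) - f (y (Suc n))\<bar>)"
  proof (rule summableI_nonneg_bounded)
    fix M
    define I where "I n = (y (Suc n), y n)" for n
    \<comment> \<open>Absolute continuity concerns sets of intervals; strict decrease makes I
      injective and turns sums over such sets into sums over indices.\<close>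
    have inj: "inj_on I A" for A
    proof (rule inj_onI)
      fix m n assume "I m = I n"
      then have "y m = y n" by (simp add: I_def)
      then show "m = n" using y_strict[of m n] y_strict[of n m] by (cases m n rule: linorder_cases) auto
    qed
    have sum: "(\<Sum>(u, v)\<in>I ` {..<M}. F u v) = (\<Sum>n<M. F (y (Suc n)) (y n))" for F :: "real \<Rightarrow> real \<Rightarrow> real"
      by (subst sum.reindex[OF inj]) (simp add: I_def)
    have disj: "{fst (I m)<..<snd (I m)} \<inter> {fst (I n)<..<snd (I n)} = {}" if "m < n" for m n
      using y_dec[of "Suc m" n] that by (auto simp: I_def)
    have "(\<Sum>(u, v)\<in>I ` {..<M}. \<bar>f v - f u\<bar>) < 1"
    proof (rule d)
      show "\<forall>(u, v)\<in>I ` {..<M}. a \<le> u \<and> u \<le> v \<and> v \<le> b"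
        using ab y_dec[OF le_SucI[OF le_refl]] by (auto simp: I_def y_def)
      show "\<forall>p\<in>I ` {..<M}. \<forall>q\<in>I ` {..<M}. p \<noteq> q \<longrightarrow> {fst p<..<snd p} \<inter> {fst q<..<snd q} = {}"
      proof (intro ballI impI; elim imageE)
        fix p q m n assume "p \<noteq> q" and I: "p = I m" "q = I n"
        then have "m < n \<or> n < m" by (cases m n rule: linorder_cases) auto
        then show "{fst p<..<snd p} \<inter> {fst q<..<snd q} = {}"
          using disj[of m n] disj[of n m] I by blast
      qed
      have "(\<Sum>(u, v)\<in>I ` {..<M}. v - u) = y 0 - y M"
        unfolding sum by (rule sum_lessThan_telescope')
      also have "\<dots> < d" using N[of "M + N"] by (simp add: y_def abs_minus_commute)
      finally show "(\<Sum>(u, v)\<in>I ` {..<M}. v - u) < d" .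
    qed simp
    then show "(\<Sum>n<M. \<bar>f (y n) - f (y (Suc n))\<bar>) \<le> 1" unfolding sum by simp
  qed simp
  then show ?thesis
    using summable_iff_shift[of "\<lambda>n. \<bar>f (x n) - f (x (Suc n))\<bar>" N] by (simp add: y_def)
qed

text \<open>The values of ln u at which the sine is alternately 1 and -1.\<close>

definition crest :: "nat \<Rightarrow> real" where
  "crest n = real n * pi + pi / 2"

lemma crest_bounds: "0 < crest n" "real n \<le> crest n" "crest n \<le> 4 * real (Suc n)"
proof -
  have *: "real n * 1 \<le> real n * pi" "real n * pi \<le> real n * 4"
    using pi_ge_two pi_less_4 by (intro mult_left_mono; simp)+
  have "0 < real n * pi + pi / 2" using pi_gt_zero by (intro add_nonneg_pos) auto
  then show "0 < crest n" by (simp add: crest_def)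
  show "real n \<le> crest n"
    using *(1) pi_gt_zero unfolding crest_def by linarith
  have "4 * real (Suc n) = real n * 4 + 4" by simp
  then show "crest n \<le> 4 * real (Suc n)"
    using *(2) pi_less_4 unfolding crest_def by linarith
qed

lemma wave_crest: "wave (exp (crest n)) = (-1) ^ n / crest n"
  by (simp add: wave_def sinc_def crest_def sin_add)

lemma crest_less: "crest n < crest (Suc n)"
  using pi_gt_zero by (simp add: crest_def algebra_simps)

lemma crest_at_top: "filterlim (\<lambda>n. exp (crest n)) at_top sequentially"
proof -
  have "filterlim crest at_top sequentially"
    by (rule filterlim_at_top_mono[OF filterlim_real_sequentially]) (simp add: crest_bounds)
  then show ?thesis by (rule filterlim_compose[OF exp_at_top])
qed

lemma not_summable_inverse_crest: "\<not> summable (\<lambda>n. 1 / crest n)"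
proof
  assume s: "summable (\<lambda>n. 1 / crest n)"
  have "summable (\<lambda>n. 1 / 4 * inverse (real (Suc n)))"
  proof (rule summable_comparison_test'[OF s])
    fix n
    have "1 / (4 * real (Suc n)) \<le> 1 / crest n"
      using crest_bounds[of n] by (intro divide_left_mono) auto
    then show "norm (1 / 4 * inverse (real (Suc n))) \<le> 1 / crest n"
      by (simp add: field_simps)
  qed
  then have "summable (\<lambda>n. inverse (real (Suc n)))" by (subst (asm) summable_cmult_iff) simp
  then have "summable (\<lambda>n. inverse (real n))" by (subst (asm) summable_Suc_iff)
  then show False using not_summable_harmonic[where 'a = real] by simp
qed

text \<open>Transfers lower bounds on increments of ln \<bar>h'\<bar> to h' itself, provided ln
  \<bar>h'\<bar> is bounded below.\<close>

lemma exp_diff_ge: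
  fixes m x y :: real
  assumes "m \<le> x" "m \<le> y"
  shows "exp m * \<bar>x - y\<bar> \<le> \<bar>exp x - exp y\<bar>"
proof -
  have *: "exp m * (x - y) \<le> exp x - exp y" if "m \<le> y" "y \<le> x" for x y
  proof -
    have "exp m * (x - y) \<le> exp y * (exp (x - y) - 1)"
    proof (rule mult_mono)
      show "x - y \<le> exp (x - y) - 1" using exp_ge_add_one_self[of "x - y"] by linarith
    qed (use that in auto)
    then show ?thesis by (simp add: algebra_simps exp_add[symmetric])
  qed
  show ?thesis
    using *[of y x] *[of x y] assms by (cases "y \<le> x") (auto simp: abs_minus_commute[of x y] abs_minus_commute[of "exp x"])
qed

text \<open>Intended for f = h' and w = ln \<bar>h'\<bar>. Between consecutive crests w changes by
  at least \<bar>\<kappa>\<bar> / crest n up to an error that is exponentially small in n. Summable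
  increments of f would therefore make 1 / crest n summable, against the divergence of the harmonic
  series.\<close>

lemma not_abs_cont_if_oscillating:
  fixes f w :: "real \<Rightarrow> real"
  assumes "0 < \<epsilon>" and ac: "abs_cont_on (-\<epsilon>) \<epsilon> f" and s: "\<bar>s\<bar> = 1"
    and f: "\<forall>\<^sub>F u in at_top. f (exp (- u)) = s * exp (w u)"
    and w: "\<forall>\<^sub>F u in at_top. \<bar>w u - (c + \<kappa> * wave u)\<bar> \<le> K / u"
    and "0 < K" and "\<kappa> \<noteq> 0"
  shows False
proof -
  have "((\<lambda>u. exp (- u)) \<longlongrightarrow> (0::real)) at_top"
    by (rule filterlim_compose[OF exp_at_bot filterlim_uminus_at_bot_at_top])
  then have small: "\<forall>\<^sub>F u::real in at_top. exp (- u) < \<epsilon>" using \<open>0 < \<epsilon>\<close> by (rule order_tendstoD)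
  \<comment> \<open>A lower bound for w that tends to c; eventually w exceeds c - 1, which serves as
    m in \<open>exp_diff_ge\<close>.\<close>
  have "((\<lambda>u. (c + \<kappa> * wave u) - K / u) \<longlongrightarrow> (c + \<kappa> * 0) - 0) at_top"
    by (intro tendsto_intros wave_tendsto tendsto_divide_at_top)
  then have "\<forall>\<^sub>F u in at_top. c - 1 < (c + \<kappa> * wave u) - K / u"
    by (rule order_tendstoD) simp
  with w have low: "\<forall>\<^sub>F u in at_top. c - 1 \<le> w u" by eventually_elim linarith
  have "\<forall>\<^sub>F u in at_top. exp (- u) < \<epsilon> \<and> c - 1 \<le> w u \<and> f (exp (- u)) = s * exp (w u) \<and>
      \<bar>w u - (c + \<kappa> * wave u)\<bar> \<le> K / u"
    using small low f w by eventually_elim simp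
  then have "\<forall>\<^sub>F n in sequentially. exp (- exp (crest n)) < \<epsilon> \<and> c - 1 \<le> w (exp (crest n)) \<and>
      f (exp (- exp (crest n))) = s * exp (w (exp (crest n))) \<and>
      \<bar>w (exp (crest n)) - (c + \<kappa> * wave (exp (crest n)))\<bar> \<le> K / exp (crest n)"
    by (rule eventually_compose_filterlim[OF _ crest_at_top])
  then obtain N where N: "\<And>n. N \<le> n \<Longrightarrow> exp (- exp (crest n)) < \<epsilon> \<and> c - 1 \<le> w (exp (crest n)) \<and>
      f (exp (- exp (crest n))) = s * exp (w (exp (crest n))) \<and>
      \<bar>w (exp (crest n)) - (c + \<kappa> * wave (exp (crest n)))\<bar> \<le> K / exp (crest n)"
    unfolding eventually_sequentially by blast
  define W where "W n = w (exp (crest n))" for n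
  define V where "V n = \<bar>f (exp (- exp (crest n))) - f (exp (- exp (crest (Suc n))))\<bar>" for n
  have "summable (\<lambda>n. V (n + N))"
    unfolding V_def add_Suc[symmetric]
  proof (rule summable_increments_if_abs_cont_on[OF ac, of "\<lambda>n. exp (- exp (crest (n + N)))"])
    show "exp (- exp (crest (Suc n + N))) < exp (- exp (crest (n + N)))" for n
      using crest_less by simp
    show "exp (- exp (crest (n + N))) \<in> {-\<epsilon>..\<epsilon>}" for n
    proof -
      have "exp (- exp (crest (n + N))) < \<epsilon>" "0 < exp (- exp (crest (n + N)))"
        using N[of "n + N"] by simp_all
      then show ?thesis unfolding atLeastAtMost_iff by linarith
    qed
  qed
  then have "summable V" by simp
  moreover have "summable (\<lambda>n. exp (-1) ^ n :: real)" by (rule summable_geometric) simp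
  \<comment> \<open>The majorant for 1 / crest n: exp (1 - c) undoes the factor exp (c - 1) from
    \<open>exp_diff_ge\<close>, and the geometric term collects the errors at two neighbouring
    crests.\<close>
  ultimately have S: "summable (\<lambda>n. inverse \<bar>\<kappa>\<bar> * (exp (1 - c) * V n + 2 * K * exp (-1) ^ n))"
    by (intro summable_mult summable_add)
  have "1 / crest n \<le> inverse \<bar>\<kappa>\<bar> * (exp (1 - c) * V n + 2 * K * exp (-1) ^ n)" if n: "N \<le> n" for n
  proof -
    have Kb: "K / exp (crest m) \<le> K * exp (-1) ^ n" if "n \<le> m" for m
    proof -
      have "exp (- crest m) \<le> exp (real n * -1)"
        using crest_bounds(2)[of m] that by simp
      also have "\<dots> = exp (-1) ^ n" by (rule exp_of_nat_mult)
      finally show ?thesis using \<open>0 < K\<close> by (simp add: exp_minus divide_inverse)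
    qed
    have W: "\<bar>W m - (c + \<kappa> * ((-1) ^ m / crest m))\<bar> \<le> K * exp (-1) ^ n" if "n \<le> m" for m
      using N[of m] Kb[OF that] that n by (simp add: W_def wave_crest)
    \<comment> \<open>Signs alternate along the crests, so consecutive heights add up instead of
      cancelling.\<close>
    have "\<kappa> * ((-1) ^ n / crest n) - \<kappa> * ((-1) ^ Suc n / crest (Suc n))
        = (-1) ^ n * \<kappa> * (1 / crest n + 1 / crest (Suc n))"
      by (simp add: algebra_simps)
    then have "\<bar>\<kappa> * ((-1) ^ n / crest n) - \<kappa> * ((-1) ^ Suc n / crest (Suc n))\<bar>
        = \<bar>\<kappa>\<bar> * (1 / crest n + 1 / crest (Suc n))"
      using crest_bounds(1)[of n] crest_bounds(1)[of "Suc n"] by (simp add: abs_mult power_abs)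
    moreover have "\<bar>\<kappa>\<bar> * (1 / crest n) \<le> \<bar>\<kappa>\<bar> * (1 / crest n + 1 / crest (Suc n))"
      using crest_bounds(1)[of "Suc n"] by (intro mult_left_mono) auto
    ultimately have "\<bar>\<kappa>\<bar> * (1 / crest n) \<le> \<bar>W n - W (Suc n)\<bar> + 2 * K * exp (-1) ^ n"
      using W[of n] W[of "Suc n"] by linarith
    also have "\<bar>W n - W (Suc n)\<bar> \<le> exp (1 - c) * V n"
    proof -
      have "exp (c - 1) * \<bar>W n - W (Suc n)\<bar> \<le> \<bar>exp (W n) - exp (W (Suc n))\<bar>"
        using N[of n] N[of "Suc n"] n by (intro exp_diff_ge) (auto simp: W_def)
      also have "\<dots> = V n"
      proof -
        have "V n = \<bar>s * (exp (W n) - exp (W (Suc n)))\<bar>"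
          using N[of n] N[of "Suc n"] n by (simp add: V_def W_def right_diff_distrib)
        then show ?thesis using s by (simp add: abs_mult)
      qed
      finally have "exp (1 - c) * (exp (c - 1) * \<bar>W n - W (Suc n)\<bar>) \<le> exp (1 - c) * V n"
        by (rule mult_left_mono) simp
      then show ?thesis by (simp add: mult.assoc[symmetric] exp_add[symmetric])
    qed
    finally have "inverse \<bar>\<kappa>\<bar> * (\<bar>\<kappa>\<bar> * (1 / crest n))
        \<le> inverse \<bar>\<kappa>\<bar> * (exp (1 - c) * V n + 2 * K * exp (-1) ^ n)"
      by (intro mult_left_mono) auto
    moreover have "inverse \<bar>\<kappa>\<bar> * (\<bar>\<kappa>\<bar> * (1 / crest n)) = 1 / crest n"
      using \<open>\<kappa> \<noteq> 0\<close> by simp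
    ultimately show ?thesis by (simp only:)
  qed
  then have "summable (\<lambda>n. 1 / crest n)"
    using crest_bounds(1) by (intro summable_comparison_test'[OF S, of N]) (auto simp: less_imp_le)
  then show False using not_summable_inverse_crest by simp
qed

lemma not_C1ac_conjugate_time_map:
  assumes a: "\<bar>\<alpha>\<bar> \<le> 1" and b: "\<bar>\<beta>\<bar> \<le> 1" and ne: "\<alpha> \<noteq> \<beta>"
  shows "\<not> C1ac_conjugate (time_map \<alpha> 1) (time_map \<beta> 1)"
proof
  assume "C1ac_conjugate (time_map \<alpha> 1) (time_map \<beta> 1)"
  then obtain h k where hk: "C1_diffeo_germ h k" "germ_eq (h \<circ> time_map \<alpha> 1 \<circ> k) (time_map \<beta> 1)"
    and "C1ac_germ h"
    by (auto simp: C1ac_conjugate_def)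
  then obtain \<epsilon> where "0 < \<epsilon>" and h_ac: "C1ac_on (-\<epsilon>) \<epsilon> h" by (auto simp: C1ac_germ_def)
  obtain D where "D \<noteq> 0"
    and "\<forall>\<^sub>F x in nhds 0. h x = sgn D * lift (\<lambda>u. unclock \<beta> (clock \<alpha> u - ln \<bar>D\<bar>)) x"
    using conjugacy_form[OF a b hk] by blast
  then obtain r where "0 < r"
    and h: "\<And>x. \<bar>x\<bar> < r \<Longrightarrow> h x = sgn D * lift (\<lambda>u. unclock \<beta> (clock \<alpha> u - ln \<bar>D\<bar>)) x"
    unfolding eventually_nhds_metric by (auto simp: dist_real_def)
  define P where "P u = unclock \<beta> (clock \<alpha> u - ln \<bar>D\<bar>)" for u
  define P' where "P' u = (1 + \<beta> * slope (P u)) / (1 + \<alpha> * slope u)" for u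
  \<comment> \<open>By \<open>lift_deriv\<close> this is ln \<bar>h'\<bar> at exp (- u) for large
    u.\<close>
  define w where "w u = u - P u + ln (P' u)" for u
  have P: "(P has_real_derivative P' u) (at u)" for u
  proof -
    have "((\<lambda>u. clock \<alpha> u - ln \<bar>D\<bar>) has_real_derivative 1 / (1 + \<alpha> * slope u)) (at u)"
      by (auto intro!: derivative_eq_intros clock_deriv[OF a])
    from DERIV_chain2[OF unclock_deriv[OF b] this] show ?thesis
      by (simp add: P_def[abs_def] P'_def)
  qed
  have P'_pos: "0 < P' u" for u
    using mult_slope_pos[OF a, of u] mult_slope_pos[OF b, of "P u"] by (simp add: P'_def)
  \<comment> \<open>The right side of the origin suffices. The condition on u places exp (- u)
    inside both the interval of absolute continuity and the one on which h has its explicit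
    form.\<close>
  have h': "deriv_on (-\<epsilon>) \<epsilon> h (exp (- u)) = sgn D * exp (w u)" if u: "exp (- u) < min \<epsilon> r" for u
  proof (rule deriv_on_eq)
    have "(lift P has_real_derivative exp (u - P u) * P' u) (at (exp (- u)))"
      by (rule lift_deriv[OF _ _ P]) auto
    then have "((\<lambda>x. sgn D * lift P x) has_real_derivative sgn D * (exp (u - P u) * P' u)) (at (exp (- u)))"
      by (rule DERIV_cmult)
    then have "(h has_real_derivative sgn D * (exp (u - P u) * P' u)) (at (exp (- u)))"
    proof (rule has_field_derivative_transform_within_open)
      show "exp (- u) \<in> {-r<..<r}"
        using u \<open>0 < r\<close> exp_gt_zero[of "- u"] unfolding greaterThanLessThan_iff min_less_iff_conj by linarith
      show "sgn D * lift P x = h x" if "x \<in> {-r<..<r}" for x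
        using h[of x] that by (auto simp: P_def[abs_def])
    qed simp
    moreover have "exp (w u) = exp (u - P u) * P' u"
      using P'_pos by (simp add: w_def exp_add)
    ultimately show "(h has_real_derivative sgn D * exp (w u)) (at (exp (- u)) within {-\<epsilon>..\<epsilon>})"
      by (simp add: has_field_derivative_at_within)
    show "-\<epsilon> < \<epsilon>" using \<open>0 < \<epsilon>\<close> by simp
    show "exp (- u) \<in> {-\<epsilon>..\<epsilon>}"
      using u \<open>0 < \<epsilon>\<close> exp_gt_zero[of "- u"] unfolding atLeastAtMost_iff min_less_iff_conj by linarith
  qed
  have "((\<lambda>u. exp (- u)) \<longlongrightarrow> (0::real)) at_top"
    by (rule filterlim_compose[OF exp_at_bot filterlim_uminus_at_bot_at_top])
  then have "\<forall>\<^sub>F u::real in at_top. exp (- u) < min \<epsilon> r"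
    using \<open>0 < \<epsilon>\<close> \<open>0 < r\<close> by (intro order_tendstoD) auto
  then have f: "\<forall>\<^sub>F u in at_top. deriv_on (-\<epsilon>) \<epsilon> h (exp (- u)) = sgn D * exp (w u)"
    by eventually_elim (rule h')
  obtain K where "0 < K"
    and "\<forall>\<^sub>F u in at_top. \<bar>w u - (ln \<bar>D\<bar> + (\<alpha> - \<beta>) * wave u)\<bar> \<le> K / u"
    using transition_asymp[OF a b, of "ln \<bar>D\<bar>"] by (auto simp: w_def P'_def P_def)
  moreover have "abs_cont_on (-\<epsilon>) \<epsilon> (deriv_on (-\<epsilon>) \<epsilon> h)" using h_ac by (simp add: C1ac_on_def)
  moreover have "\<bar>sgn D\<bar> = 1" using \<open>D \<noteq> 0\<close> by (simp add: abs_sgn_eq)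
  moreover have "\<alpha> - \<beta> \<noteq> 0" using ne by simp
  ultimately show False
    using not_abs_cont_if_oscillating[OF \<open>0 < \<epsilon>\<close> _ _ f] by blast
qed

theorem theoremC:
  shows "\<exists>(I :: real set) (X :: real \<Rightarrow> real \<Rightarrow> real) (F :: real \<Rightarrow> real \<Rightarrow> real).
    C1ac_continuous_path I X \<and>
    (\<forall>\<alpha>\<in>I. hyperbolic_germ (X \<alpha>)) \<and>
    (\<exists>\<alpha>\<in>I. germ_eq (X \<alpha>) (\<lambda>x. - x)) \<and>
    (\<forall>\<alpha>\<in>I. time_one_germ (X \<alpha>) (F \<alpha>)) \<and>
    (\<forall>\<alpha>\<in>I. \<forall>\<beta>\<in>I. \<alpha> \<noteq> \<beta> \<longrightarrow>
       C1_conjugate (F \<alpha>) (F \<beta>) \<and> \<not> C1ac_conjugate (F \<alpha>) (F \<beta>))"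
proof (rule exI[of _ "{-1..1}"], rule exI[of _ hyp_field], rule exI[of _ "\<lambda>\<alpha>. time_map \<alpha> 1"],
    intro conjI ballI impI)
  have bound: "\<bar>\<alpha>\<bar> \<le> 1" if "\<alpha> \<in> {-1..1}" for \<alpha> :: real using that by auto
  show "C1ac_continuous_path {-1..1} hyp_field" by (rule C1ac_continuous_path_hyp_field)
  show "hyperbolic_germ (hyp_field \<alpha>)" for \<alpha> by (rule hyperbolic_germ_hyp_field)
  show "\<exists>\<alpha>\<in>{-1..1}. germ_eq (hyp_field \<alpha>) (\<lambda>x. - x)"
    by (intro bexI[of _ 0]) (auto simp: germ_eq_def hyp_field_def)
  show "time_one_germ (hyp_field \<alpha>) (time_map \<alpha> 1)" if "\<alpha> \<in> {-1..1}" for \<alpha>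
    by (rule time_one_germ_time_map[OF bound[OF that]])
  show "C1_conjugate (time_map \<alpha> 1) (time_map \<beta> 1)"
    if "\<alpha> \<in> {-1..1}" "\<beta> \<in> {-1..1}" for \<alpha> \<beta>
    by (rule C1_conjugate_time_map[OF that[THEN bound]])
  show "\<not> C1ac_conjugate (time_map \<alpha> 1) (time_map \<beta> 1)"
    if "\<alpha> \<in> {-1..1}" "\<beta> \<in> {-1..1}" "\<alpha> \<noteq> \<beta>" for \<alpha> \<beta>
    by (rule not_C1ac_conjugate_time_map[OF that(1,2)[THEN bound] that(3)])
qed

end
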